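(* Let $G=\mathrm{SL}(n)^d$, $T=\mathrm{ST}(n)^d$, let $\pi:G\to\mathrm{GL}(V)$ be a rational representation and $v\in V\setminus\{0\}$. Suppose $\mu_T(t\cdot v)=\mu_G(t\cdot v)$ for all $t\in T$. Then for every $R>0$, $$\inf_{g\in B_R}f_v(g)=\inf_{g\in T\cap B_R}f_v(g),$$ where $f_v(g):=\langle v,g\cdot v\rangle$ and $B_R$ is the geodesic ball of radius $R$ about the identity.
   Context: $G=\mathrm{SL}(n)^d$, $K=\mathrm{SU}(n)^d$, $T=\mathrm{ST}(n)^d$ (tuples of diagonal determinant-one matrices), $T_K=K\cap T$, all viewed as block-diagonal subgroups of $\mathrm{GL}(dn)$. A rational representation $\pi:G\to\mathrm{GL}(V)$ is a homomorphism whose matrix entries are polynomials in the entries of $g$; write $g\cdot v=\pi(g)v$ and $\Pi(A)=\frac{d}{dt}|_{t=0}\pi(e^{tA})$. Fix a $K$-invariant Hermitian inner product $\langle\cdot,\cdot\rangle$ on $V$, linear in the second argument. For $v\neq0$, $\mu_G(v)$ is the unique $d$-tuple of traceless Hermitian matrices with $\operatorname{tr}(\mu_G(v)A)=\langle v,\Pi(A)v\rangle/\langle v,v\rangle$ for all $d$-tuples $A$ of traceless Hermitian matrices; $\mu_T(v)$ is defined likewise with $A$ and $\mu_T(v)$ ranging over $d$-tuples of real traceless diagonal matrices. Let $P$ be the set of $d$-tuples of positive-definite matrices of determinant one (the positive-definite elements of $G$), and $B_R:=\{e^A: A=(A_1,\dots,A_d),\ A_i\text{ traceless Hermitian},\ \|A\|_F\leq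 R\}\subseteq P$, where $\|A\|_F^2=\sum_i\|A_i\|_F^2$. *)

theory Defs
  imports "HOL-Analysis.Analysis"
begin

text \<open>
  A block-diagonal matrix with \<open>d\<close> blocks of size \<open>n\<close> is the tuple of its blocks, an element of
  \<^typ>\<open>complex^'n^'n^'d\<close> with \<open>n = CARD('n)\<close> and \<open>d = CARD('d)\<close>; products, exponentials, adjoints
  and traces are taken blockwise. The representation space is \<open>V = \<complex>\<^sup>m\<close> with \<open>m = CARD('m)\<close>, carrying
  an arbitrary Hermitian inner product.
\<close>

type_synonym ('n, 'd) mtuple = "complex^'n^'n^'d"

definition hconj :: "complex^'n^'n \<Rightarrow> complex^'n^'n" where
  "hconj A = (\<chi> a b. cnj (A $ b $ a))"

definition diagonal :: "complex^'n^'n \<Rightarrow> bool" where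
  "diagonal A \<longleftrightarrow> (\<forall>a b. a \<noteq> b \<longrightarrow> A $ a $ b = 0)"

text \<open>The library's power on \<^typ>\<open>complex^'n^'n\<close> is entrywise and there is no \<^const>\<open>exp\<close> at this
  type, hence the following two definitions.\<close>

primrec matpow :: "complex^'n^'n \<Rightarrow> nat \<Rightarrow> complex^'n^'n" where
  "matpow A 0 = mat 1"
| "matpow A (Suc k) = A ** matpow A k"

definition mexp :: "complex^'n^'n \<Rightarrow> complex^'n^'n" where
  "mexp A = (\<Sum>k. (1 / fact k) *\<^sub>R matpow A k)"

definition tmult :: "('n::finite, 'd::finite) mtuple \<Rightarrow> ('n, 'd) mtuple \<Rightarrow> ('n, 'd) mtuple"
  where "tmult g h = (\<chi> i. g $ i ** h $ i)"

definition tone :: "('n::finite, 'd::finite) mtuple"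
  where "tone = (\<chi> i. mat 1)"

definition texp :: "('n::finite, 'd::finite) mtuple \<Rightarrow> ('n, 'd) mtuple"
  where "texp A = (\<chi> i. mexp (A $ i))"

definition ttrace :: "('n::finite, 'd::finite) mtuple \<Rightarrow> complex"
  where "ttrace A = (\<Sum>i\<in>UNIV. trace (A $ i))"

definition SL :: "('n::finite, 'd::finite) mtuple set" where
  "SL = {g. \<forall>i. det (g $ i) = 1}"

definition SU :: "('n::finite, 'd::finite) mtuple set" where
  "SU = {g \<in> SL. \<forall>i. hconj (g $ i) ** g $ i = mat 1}"

definition ST :: "('n::finite, 'd::finite) mtuple set" where
  "ST = {g \<in> SL. \<forall>i. diagonal (g $ i)}"

definition herm0 :: "('n::finite, 'd::finite) mtuple set" where
  "herm0 = {A. \<forall>i. hconj (A $ i) = A $ i \<and> trace (A $ i) = 0}"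

definition rdiag0 :: "('n::finite, 'd::finite) mtuple set" where
  "rdiag0 = {A. \<forall>i. diagonal (A $ i) \<and> (\<forall>a. A $ i $ a $ a \<in> \<real>) \<and> trace (A $ i) = 0}"

text \<open>A function agreeing on \<^const>\<open>SL\<close> with a polynomial in the entries of the tuple: \<open>M\<close> is a finite
  set of exponent vectors and \<open>c\<close> gives the coefficients.\<close>

definition polynomial_on_SL :: "(('n::finite, 'd::finite) mtuple \<Rightarrow> complex) \<Rightarrow> bool" where
  "polynomial_on_SL f \<longleftrightarrow>
     (\<exists>(M :: ('d \<Rightarrow> 'n \<Rightarrow> 'n \<Rightarrow> nat) set) c. finite M \<and>
        (\<forall>g\<in>SL. f g = (\<Sum>e\<in>M. c e *
           (\<Prod>i\<in>UNIV. \<Prod>a\<in>UNIV. \<Prod>b\<in>UNIV. (g $ i $ a $ b) ^ e i a b))))"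

definition rational_representation ::
  "(('n::finite, 'd::finite) mtuple \<Rightarrow> complex^'m^'m) \<Rightarrow> bool" where
  "rational_representation \<pi> \<longleftrightarrow>
     (\<forall>g\<in>SL. invertible (\<pi> g)) \<and>
     \<pi> tone = mat 1 \<and>
     (\<forall>g\<in>SL. \<forall>h\<in>SL. \<pi> (tmult g h) = \<pi> g ** \<pi> h) \<and>
     (\<forall>p q. polynomial_on_SL (\<lambda>g. \<pi> g $ p $ q))"

definition hermitian_inner_product :: "(complex^'m \<Rightarrow> complex^'m \<Rightarrow> complex) \<Rightarrow> bool" where
  "hermitian_inner_product H \<longleftrightarrow>
     (\<forall>x y z. H x (y + z) = H x y + H x z) \<and>
     (\<forall>x y c. H x (c *s y) = c * H x y) \<and>
     (\<forall>x y. H y x = cnj (H x y)) \<and>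
     (\<forall>x. x \<noteq> 0 \<longrightarrow> Re (H x x) > 0)"

definition SU_invariant ::
  "(('n::finite, 'd::finite) mtuple \<Rightarrow> complex^'m^'m) \<Rightarrow>
   (complex^'m \<Rightarrow> complex^'m \<Rightarrow> complex) \<Rightarrow> bool" where
  "SU_invariant \<pi> H \<longleftrightarrow> (\<forall>k\<in>SU. \<forall>x y. H (\<pi> k *v x) (\<pi> k *v y) = H x y)"

definition lie_rep ::
  "(('n::finite, 'd::finite) mtuple \<Rightarrow> complex^'m^'m) \<Rightarrow>
   ('n, 'd) mtuple \<Rightarrow> complex^'m^'m" where
  "lie_rep \<pi> A = vector_derivative (\<lambda>t::real. \<pi> (texp (t *\<^sub>R A))) (at 0)"

definition moment_map ::
  "('n::finite, 'd::finite) mtuple set \<Rightarrow> (('n, 'd) mtuple \<Rightarrow> complex^'m^'m) \<Rightarrow>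
   (complex^'m \<Rightarrow> complex^'m \<Rightarrow> complex) \<Rightarrow> complex^'m \<Rightarrow> ('n, 'd) mtuple" where
  "moment_map S \<pi> H v = (THE M. M \<in> S \<and>
     (\<forall>A\<in>S. ttrace (tmult M A) = H v (lie_rep \<pi> A *v v) / H v v))"

definition moment_G ::
  "(('n::finite, 'd::finite) mtuple \<Rightarrow> complex^'m^'m) \<Rightarrow>
   (complex^'m \<Rightarrow> complex^'m \<Rightarrow> complex) \<Rightarrow> complex^'m \<Rightarrow> ('n, 'd) mtuple" where
  "moment_G = moment_map herm0"

definition moment_T ::
  "(('n::finite, 'd::finite) mtuple \<Rightarrow> complex^'m^'m) \<Rightarrow>
   (complex^'m \<Rightarrow> complex^'m \<Rightarrow> complex) \<Rightarrow> complex^'m \<Rightarrow> ('n, 'd) mtuple" where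
  "moment_T = moment_map rdiag0"

text \<open>The library norm on \<^typ>\<open>complex^'n^'n^'d\<close> is the Frobenius norm of the tuple.\<close>

lemma norm_mtuple_Frobenius:
  fixes A :: "('n::finite, 'd::finite) mtuple"
  shows "norm A = sqrt (\<Sum>i\<in>UNIV. \<Sum>a\<in>UNIV. \<Sum>b\<in>UNIV. (cmod (A $ i $ a $ b))\<^sup>2)"
  by (simp add: norm_vec_def L2_set_def sum_nonneg)

definition geodesic_ball :: "real \<Rightarrow> ('n::finite, 'd::finite) mtuple set" where
  "geodesic_ball R = texp ` {A \<in> herm0. norm A \<le> R}"

text \<open>For \<open>g\<close> in a geodesic ball, \<open>\<pi> g\<close> is self-adjoint for the invariant inner product, so
  \<open>\<langle>v, g \<cdot> v\<rangle>\<close> is real there and equals its real part.\<close>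

definition fv ::
  "(('n::finite, 'd::finite) mtuple \<Rightarrow> complex^'m^'m) \<Rightarrow>
   (complex^'m \<Rightarrow> complex^'m \<Rightarrow> complex) \<Rightarrow> complex^'m \<Rightarrow> ('n, 'd) mtuple \<Rightarrow> real" where
  "fv \<pi> H v g = Re (H v (\<pi> g *v v))"

end

theory Submission
  imports Defs "HOL-Complex_Analysis.Conformal_Mappings"
begin

text \<open>
  Let \<open>e\<^sup>A\<close> minimise \<open>f\<^sub>v\<close> on the compact set \<open>T \<inter> B\<^sub>R\<close>, and join it to a point \<open>e\<^sup>C\<close> of \<open>B\<^sub>R\<close> by the
  geodesic \<open>e\<^sup>A\<^sup>/\<^sup>2 e\<^sup>s\<^sup>B e\<^sup>A\<^sup>/\<^sup>2\<close>. The function \<open>f\<^sub>v\<close> is convex along it, with initial slope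
  \<open>\<langle>w, \<Pi>(B) w\<rangle>\<close> for \<open>w = e\<^sup>A\<^sup>/\<^sup>2 \<cdot> v\<close>. As \<open>\<mu>\<^sub>G(w) = \<mu>\<^sub>T(w)\<close>, this slope depends only on the diagonal part
  of \<open>B\<close>. Nonpositive curvature gives \<open>\<parallel>A\<parallel>\<^sup>2 + 2 \<langle>A, B\<rangle> \<le> \<parallel>C\<parallel>\<^sup>2\<close>, so the diagonal part of \<open>B\<close> does not point
  out of the ball at \<open>A\<close>, and the slope is nonnegative by minimality of \<open>A\<close> on the torus.

  The curvature inequality comes from the convexity of \<open>s \<mapsto> ln det (1 + \<tau> e\<^sup>A\<^sup>/\<^sup>2 e\<^sup>s\<^sup>B e\<^sup>A\<^sup>/\<^sup>2)\<close> for every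
  \<open>\<tau> > 0\<close>: in terms of eigenvalues these functions are sums of \<open>ln (1 + \<tau> e\<^sup>c)\<close>, and integrating over
  \<open>ln \<tau>\<close> turns them into sums of \<open>c\<^sup>2 / 2\<close>.
\<close>

section \<open>Hermitian matrices\<close>

definition diag_mat :: "('n \<Rightarrow> complex) \<Rightarrow> complex^'n^'n" where
  "diag_mat d = (\<chi> a b. if a = b then d a else 0)"

lemma diag_mat_nth [simp]: "diag_mat d $ a $ b = (if a = b then d a else 0)"
  by (simp add: diag_mat_def)

lemma hconj_nth [simp]: "hconj A $ a $ b = cnj (A $ b $ a)"
  by (simp add: hconj_def)

lemma matrix_add_rdistrib: "(A + B) ** C = A ** C + B ** (C :: complex^'n^'m)"
  by (simp add: vec_eq_iff matrix_matrix_mult_def sum.distrib distrib_right)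

lemma matrix_diff_ldistrib: "A ** (B - C) = A ** B - A ** (C :: complex^'n^'m)"
  by (simp add: vec_eq_iff matrix_matrix_mult_def sum_subtractf right_diff_distrib)

lemma matrix_diff_rdistrib: "(A - B) ** C = A ** C - B ** (C :: complex^'n^'m)"
  by (simp add: vec_eq_iff matrix_matrix_mult_def sum_subtractf left_diff_distrib)

lemma hconj_mult: "hconj (A ** B) = hconj B ** hconj (A :: complex^'n^'n)"
  by (simp add: vec_eq_iff matrix_matrix_mult_def mult.commute)

lemma hconj_hconj [simp]: "hconj (hconj A) = A"
  by (simp add: vec_eq_iff)

lemma hconj_add: "hconj (A + B) = hconj A + hconj B"
  by (simp add: vec_eq_iff)

lemma hconj_diff: "hconj (A - B) = hconj A - hconj B"
  by (simp add: vec_eq_iff)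

lemma hconj_mat_1 [simp]: "hconj (mat 1) = mat 1"
  by (simp add: vec_eq_iff mat_def)

lemma hconj_diag_mat: "hconj (diag_mat d) = diag_mat (\<lambda>a. cnj (d a))"
  by (simp add: vec_eq_iff)

lemma sum_two_supported:
  fixes g :: "'n::finite \<Rightarrow> 'a::comm_monoid_add"
  assumes "i \<noteq> j" "\<And>a. a \<noteq> i \<Longrightarrow> a \<noteq> j \<Longrightarrow> g a = 0"
  shows "sum g UNIV = g i + g j"
proof -
  have "sum g UNIV = sum g {i, j}"
    by (rule sum.mono_neutral_right) (use assms in auto)
  then show ?thesis using assms(1) by simp
qed

lemma sum_one_supported:
  fixes g :: "'n::finite \<Rightarrow> 'a::comm_monoid_add"
  assumes "\<And>a. a \<noteq> i \<Longrightarrow> g a = 0"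
  shows "sum g UNIV = g i"
proof -
  have "sum g UNIV = sum g {i}"
    by (rule sum.mono_neutral_right) (use assms in auto)
  then show ?thesis by simp
qed

lemma diag_mat_mult_nth: "(diag_mat d ** M) $ a $ b = d a * M $ a $ b"
  unfolding matrix_matrix_mult_def by (simp, subst sum_one_supported[of a]) auto

lemma mult_diag_mat_nth: "(M ** diag_mat d) $ a $ b = M $ a $ b * d b"
  unfolding matrix_matrix_mult_def by (simp, subst sum_one_supported[of b]) auto

lemma diag_mat_mult: "diag_mat d ** diag_mat e = diag_mat (\<lambda>a. d a * e a)"
  by (simp add: vec_eq_iff diag_mat_mult_nth)

lemma diag_mat_add: "diag_mat d + diag_mat e = diag_mat (\<lambda>a. d a + e a)"
  by (simp add: vec_eq_iff)

lemma diag_mat_1: "diag_mat (\<lambda>a. 1) = mat 1"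
  by (simp add: vec_eq_iff mat_def)

lemma det_diag_mat: "det (diag_mat d) = (\<Prod>a\<in>UNIV. d a)"
  by (subst det_diagonal) auto

lemma trace_diag_mat: "trace (diag_mat d) = (\<Sum>a\<in>UNIV. d a)"
  by (simp add: trace_def)

lemma det_hconj: "det (hconj A) = cnj (det A)"
proof -
  have "hconj A = transpose (\<chi> a b. cnj (A $ a $ b))"
    by (simp add: vec_eq_iff transpose_def)
  then have "det (hconj A) = det (\<chi> a b. cnj (A $ a $ b))"
    by (simp add: det_transpose)
  also have "\<dots> = cnj (det A)"
    by (simp add: det_def)
  finally show ?thesis .
qed

section \<open>Conjugation by unitary matrices\<close>

lemma mult_hconj_cancel:
  assumes "hconj U ** U = mat 1"
  shows "U ** hconj U = mat 1" "hconj U ** (U ** M) = M" "U ** (hconj U ** M) = M"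
proof -
  show *: "U ** hconj U = mat 1"
    using assms by (rule matrix_left_right_inverse[THEN iffD1])
  show "hconj U ** (U ** M) = M" "U ** (hconj U ** M) = M"
    using assms * by (simp_all add: matrix_mul_assoc)
qed

lemma det_unitary_conj:
  assumes "hconj U ** U = mat 1"
  shows "det (U ** M ** hconj U) = det M"
proof -
  have "det U * det (hconj U) = 1"
    using arg_cong[OF mult_hconj_cancel(1)[OF assms], of det] by (simp add: det_mul)
  then show ?thesis
    by (simp add: det_mul mult_ac)
qed

lemma trace_unitary_conj:
  assumes "hconj U ** U = mat 1"
  shows "trace (U ** M ** hconj U) = trace (M :: complex^'n^'n)"
  using assms by (subst trace_mul_sym) (simp add: matrix_mul_assoc)

text \<open>A complex Givens rotation in the plane of coordinates \<open>i\<close> and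
  \<open>j\<close>, with cosine \<open>c\<close> and sine \<open>s\<close>. The phase
  \<open>w\<close> allows an off-diagonal entry to be turned onto the real axis.\<close>

definition givens :: "'n \<Rightarrow> 'n \<Rightarrow> real \<Rightarrow> real \<Rightarrow> complex \<Rightarrow> complex^'n^'n" where
  "givens i j c s w = (\<chi> a b. if b = i then (if a = i then of_real c else if a = j then of_real s * w else 0)
     else if b = j then (if a = i then - of_real s * cnj w else if a = j then of_real c else 0)
     else if a = b then 1 else 0)"

lemma givens_sum:
  assumes "i \<noteq> j"
  shows "(\<Sum>a\<in>UNIV. x a * givens i j c s w $ a $ b) =
    (if b = i then x i * c + x j * (s * w) else if b = j then - (x i * (s * cnj w)) + x j * c else x b)"
    (is "sum ?f _ = _")
proof -
  consider "b = i" | "b = j" | "b \<noteq> i" "b \<noteq> j" by blast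
  then show ?thesis
  proof cases
    case 1
    show ?thesis by (subst sum_two_supported[OF assms]) (use assms 1 in \<open>auto simp: givens_def\<close>)
  next
    case 2
    show ?thesis by (subst sum_two_supported[OF assms]) (use assms 2 in \<open>auto simp: givens_def\<close>)
  next
    case 3
    show ?thesis by (subst sum_one_supported[of b]) (use assms 3 in \<open>auto simp: givens_def\<close>)
  qed
qed

lemma givens_sum_cnj:
  assumes "i \<noteq> j"
  shows "(\<Sum>a\<in>UNIV. cnj (givens i j c s w $ a $ b) * x a) =
    (if b = i then x i * c + x j * (s * cnj w) else if b = j then - (x i * (s * w)) + x j * c else x b)"
proof -
  have "(\<Sum>a\<in>UNIV. cnj (givens i j c s w $ a $ b) * x a)
      = cnj (\<Sum>a\<in>UNIV. cnj (x a) * givens i j c s w $ a $ b)"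
    by (simp add: mult.commute)
  then show ?thesis using assms by (simp only: givens_sum[OF assms]) simp
qed

lemma givens_unitary:
  assumes "i \<noteq> j" "c\<^sup>2 + s\<^sup>2 = 1" "cmod w = 1"
  shows "hconj (givens i j c s w) ** givens i j c s w = mat 1"
proof -
  have w: "w * cnj w = 1"
    using assms(3) complex_norm_square[of w] by simp
  have cs: "of_real c * of_real c + of_real s * of_real s = (1::complex)"
    using assms(2) by (metis of_real_1 of_real_add of_real_mult power2_eq_square)
  have *: "w * (cnj w * x) = x" for x
    using w by (simp add: mult.assoc[symmetric])
  show ?thesis
    unfolding vec_eq_iff
  proof (intro allI)
    fix a b
    show "(hconj (givens i j c s w) ** givens i j c s w) $ a $ b = mat 1 $ a $ b"
      using assms(1) cs
      by (simp add: matrix_matrix_mult_def givens_sum_cnj[OF assms(1)])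
        (auto simp: givens_def mat_def algebra_simps *)
  qed
qed

text \<open>The trace is preserved, so the two affected diagonal entries change by opposite amounts.
  The amount contains the term \<open>2 * c * s * m\<close>, linear in \<open>s\<close>, which
  dominates for small angles when the off-diagonal entry is nonzero.\<close>

lemma givens_conj_diag:
  fixes L :: "complex^'n^'n"
  assumes "i \<noteq> j" "c\<^sup>2 + s\<^sup>2 = 1" "cmod w = 1" "hconj L = L" "w * L $ i $ j = of_real m"
  defines "L' \<equiv> hconj (givens i j c s w) ** L ** givens i j c s w"
  shows "Re (L' $ i $ i) = Re (L $ i $ i) + (s\<^sup>2 * (Re (L $ j $ j) - Re (L $ i $ i)) + 2 * c * s * m)"
    "Re (L' $ j $ j) = Re (L $ j $ j) - (s\<^sup>2 * (Re (L $ j $ j) - Re (L $ i $ i)) + 2 * c * s * m)"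
    "b \<noteq> i \<Longrightarrow> b \<noteq> j \<Longrightarrow> L' $ b $ b = L $ b $ b"
proof -
  let ?V = "givens i j c s w"
  have e: "L' $ b $ b = (\<Sum>a\<in>UNIV. (\<Sum>a'\<in>UNIV. cnj (?V $ a' $ b) * L $ a' $ a) * ?V $ a $ b)" for b
    by (simp add: L'_def matrix_matrix_mult_def)
  have herm: "L $ a $ b = cnj (L $ b $ a)" for a b
    using arg_cong[OF assms(4), of "\<lambda>M. M $ a $ b"] by simp
  have ji: "cnj w * L $ j $ i = of_real m"
    using herm[of j i] assms(5) by (metis complex_cnj_complex_of_real complex_cnj_mult)
  have w: "w * cnj w = 1"
    using assms(3) complex_norm_square[of w] by simp
  have i0: "L' $ i $ i = of_real (c * c) * L $ i $ i + of_real (s * s) * (w * cnj w) * L $ j $ j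
      + of_real (c * s) * (w * L $ i $ j) + of_real (c * s) * (cnj w * L $ j $ i)"
    unfolding e givens_sum_cnj[OF assms(1)] givens_sum[OF assms(1)]
    by (simp add: algebra_simps)
  have j0: "L' $ j $ j = of_real (s * s) * (w * cnj w) * L $ i $ i + of_real (c * c) * L $ j $ j
      - of_real (c * s) * (w * L $ i $ j) - of_real (c * s) * (cnj w * L $ j $ i)"
    unfolding e givens_sum_cnj[OF assms(1)] givens_sum[OF assms(1)]
    using assms(1) by (simp add: algebra_simps)
  have cc: "c * c = 1 - s * s" using assms(2) by (simp add: power2_eq_square)
  show "Re (L' $ i $ i) = Re (L $ i $ i) + (s\<^sup>2 * (Re (L $ j $ j) - Re (L $ i $ i)) + 2 * c * s * m)"
    unfolding i0 w ji assms(5) cc by (simp add: algebra_simps power2_eq_square)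
  show "Re (L' $ j $ j) = Re (L $ j $ j) - (s\<^sup>2 * (Re (L $ j $ j) - Re (L $ i $ i)) + 2 * c * s * m)"
    unfolding j0 w ji assms(5) cc by (simp add: algebra_simps power2_eq_square)
  show "b \<noteq> i \<Longrightarrow> b \<noteq> j \<Longrightarrow> L' $ b $ b = L $ b $ b"
    unfolding e givens_sum_cnj[OF assms(1)] givens_sum[OF assms(1)] by simp
qed

section \<open>The Frobenius norm and the spectral theorem\<close>

lemma norm_matrix_power2: "(norm (A :: complex^'n^'m))\<^sup>2 = (\<Sum>a\<in>UNIV. \<Sum>b\<in>UNIV. (cmod (A $ a $ b))\<^sup>2)"
  by (simp add: norm_vec_def L2_set_def sum_nonneg)

lemma trace_hconj_mult: "trace (hconj A ** A) = of_real ((norm (A :: complex^'n^'n))\<^sup>2)"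
proof -
  have "trace (hconj A ** A) = (\<Sum>b\<in>UNIV. \<Sum>a\<in>UNIV. of_real ((cmod (A $ a $ b))\<^sup>2))"
    by (simp add: trace_def matrix_matrix_mult_def complex_norm_square mult.commute del: of_real_power)
  then show ?thesis
    unfolding norm_matrix_power2 by (subst (asm) sum.swap) simp
qed

lemma continuous_on_matrix_mult [continuous_intros]:
  fixes f g :: "'a::topological_space \<Rightarrow> complex^'n^'n"
  assumes "continuous_on S f" "continuous_on S g"
  shows "continuous_on S (\<lambda>x. f x ** g x)"
  unfolding matrix_matrix_mult_def using assms by (intro continuous_intros)

lemma continuous_on_hconj [continuous_intros]:
  fixes f :: "'a::topological_space \<Rightarrow> complex^'n^'n"
  assumes "continuous_on S f"
  shows "continuous_on S (\<lambda>x. hconj (f x))"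
  unfolding hconj_def using assms by (intro continuous_intros)

text \<open>All unitary matrices of a given size have the same Frobenius norm, since its square is
  the trace of \<open>hconj U ** U\<close>.\<close>

lemma compact_unitary: "compact {U :: complex^'n^'n. hconj U ** U = mat 1}"
proof -
  have "closed {U :: complex^'n^'n. hconj U ** U = mat 1}"
    by (intro closed_Collect_eq continuous_intros)
  moreover have "norm U \<le> sqrt (CARD('n))" if "hconj U ** U = mat 1" for U :: "complex^'n^'n"
  proof -
    have "of_real ((norm U)\<^sup>2) = (of_real (CARD('n)) :: complex)"
      using trace_hconj_mult[of U] that by (simp add: trace_I)
    then have "(norm U)\<^sup>2 = CARD('n)" using of_real_eq_iff by blast
    then show ?thesis by (metis norm_ge_zero order_refl real_sqrt_unique)
  qed
  then have "bounded {U :: complex^'n^'n. hconj U ** U = mat 1}"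
    unfolding bounded_iff by blast
  ultimately show ?thesis by (simp add: compact_eq_bounded_closed)
qed

text \<open>A variational argument: over the compact unitary group, maximise the diagonal of
  \<open>hconj U ** C ** U\<close> summed with pairwise distinct weights. At a maximiser all
  off-diagonal entries vanish, since otherwise a suitable Givens rotation would shift diagonal mass
  to the index of larger weight.\<close>

theorem hermitian_diagonalizable:
  fixes C :: "complex^'n^'n"
  assumes C: "hconj C = C"
  obtains U and d :: "'n \<Rightarrow> real"
  where "hconj U ** U = mat 1" "C = U ** diag_mat (\<lambda>a. of_real (d a)) ** hconj U"
proof -
  obtain k :: "'n \<Rightarrow> nat" where k: "inj k"
    using finite_imp_inj_to_nat_seg[of "UNIV :: 'n set"] by auto
  let ?S = "{U :: complex^'n^'n. hconj U ** U = mat 1}"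
  define F where "F U = (\<Sum>b\<in>UNIV. real (k b) * Re ((hconj U ** C ** U) $ b $ b))" for U
  have "continuous_on ?S F"
    unfolding F_def by (intro continuous_intros)
  moreover have "mat 1 \<in> ?S" by simp
  ultimately obtain U where U: "U \<in> ?S" and max: "\<And>W. W \<in> ?S \<Longrightarrow> F W \<le> F U"
    using continuous_attains_sup[OF compact_unitary] by blast
  define L where "L = hconj U ** C ** U"
  have hL: "hconj L = L"
    by (simp add: L_def hconj_mult C matrix_mul_assoc)
  have UU: "hconj U ** U = mat 1" using U by simp
  have aux: "\<not> k j < k i" if L: "L $ i $ j \<noteq> 0" for i j
  proof
    assume kij: "k j < k i"
    then have ij: "i \<noteq> j" by auto
    define m where "m = cmod (L $ i $ j)"
    have m: "m > 0" using L by (simp add: m_def)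
    define w where "w = cnj (L $ i $ j) / of_real m"
    have w: "cmod w = 1" using m by (simp add: w_def norm_divide) (simp add: m_def)
    have wm: "w * L $ i $ j = of_real m"
    proof -
      have "of_real m * of_real m = L $ i $ j * cnj (L $ i $ j)"
        using complex_norm_square[of "L $ i $ j"] by (simp add: m_def power2_eq_square)
      then show ?thesis using m by (simp add: w_def field_simps)
    qed
    define \<delta> where "\<delta> = Re (L $ j $ j) - Re (L $ i $ i)"
    \<comment> \<open>\<open>t\<close> is the tangent of the rotation angle, small enough that
      \<open>t * \<bar>\<delta>\<bar> \<le> m\<close>. The gain \<open>\<gamma>\<close> has the
      factor \<open>t * \<delta> + 2 * m\<close>, which is then positive.\<close>
    define t where "t = m / (1 + \<bar>\<delta>\<bar>)"
    have t: "t > 0" using m by (simp add: t_def add_pos_nonneg)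
    have "t * \<bar>\<delta>\<bar> \<le> m" unfolding t_def using m by (simp add: field_simps add_pos_nonneg)
    moreover have "\<bar>t * \<delta>\<bar> = t * \<bar>\<delta>\<bar>" using t by (simp add: abs_mult)
    ultimately have td: "t * \<delta> + 2 * m > 0" using m by linarith
    define q where "q = sqrt (1 + t\<^sup>2)"
    have q: "q > 0" "q\<^sup>2 = 1 + t\<^sup>2" by (auto simp: q_def add_pos_nonneg)
    have q0: "1 + t\<^sup>2 \<noteq> 0" using q by (metis less_irrefl zero_less_power)
    define c s where "c = 1 / q" and "s = t / q"
    have cs: "c\<^sup>2 + s\<^sup>2 = 1"
      unfolding c_def s_def using q q0 by (simp add: power_divide add_divide_distrib[symmetric])
    define V where "V = givens i j c s w"
    have V: "hconj V ** V = mat 1"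
      unfolding V_def by (rule givens_unitary[OF ij cs w])
    have "hconj (U ** V) ** (U ** V) = hconj V ** (hconj U ** U) ** V"
      by (simp add: hconj_mult matrix_mul_assoc)
    then have "U ** V \<in> ?S" using UU V by simp
    then have le: "F (U ** V) \<le> F U" by (rule max)
    define L' where "L' = hconj V ** L ** V"
    define \<gamma> where "\<gamma> = s\<^sup>2 * \<delta> + 2 * c * s * m"
    note D = givens_conj_diag[OF ij cs w hL wm, folded V_def L'_def, folded \<delta>_def, folded \<gamma>_def]
    have "F (U ** V) = (\<Sum>b\<in>UNIV. real (k b) * Re (L' $ b $ b))"
      by (simp add: F_def L'_def L_def hconj_mult matrix_mul_assoc)
    moreover have "F U = (\<Sum>b\<in>UNIV. real (k b) * Re (L $ b $ b))"
      by (simp add: F_def L_def)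
    ultimately have "F (U ** V) - F U = (\<Sum>b\<in>UNIV. real (k b) * (Re (L' $ b $ b) - Re (L $ b $ b)))"
      by (simp add: sum_subtractf right_diff_distrib)
    also have "\<dots> = real (k i) * \<gamma> - real (k j) * \<gamma>"
      by (subst sum_two_supported[OF ij]) (use D in auto)
    also have "\<dots> = (real (k i) - real (k j)) * \<gamma>"
      by (simp add: left_diff_distrib)
    also have "\<gamma> = t * (t * \<delta> + 2 * m) / q\<^sup>2"
      by (simp add: \<gamma>_def c_def s_def power_divide add_divide_distrib ring_distribs power2_eq_square mult_ac)
    also have "(real (k i) - real (k j)) * (t * (t * \<delta> + 2 * m) / q\<^sup>2) > 0"
      using kij t td q(1) by (intro mult_pos_pos divide_pos_pos) auto
    finally show False using le by simp
  qed
  have off: "L $ i $ j = 0" if "i \<noteq> j" for i j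
  proof (rule ccontr)
    assume nz: "L $ i $ j \<noteq> 0"
    then have "L $ j $ i \<noteq> 0"
      using arg_cong[OF hL, of "\<lambda>M. M $ i $ j"] by auto
    then have "k i = k j" using aux[OF nz] aux[of j i] by simp
    then show False using that k by (auto dest: injD)
  qed
  have diag: "L $ i $ i = of_real (Re (L $ i $ i))" for i
    using arg_cong[OF hL, of "\<lambda>M. M $ i $ i"]
    by (metis Reals_cnj_iff hconj_nth of_real_Re)
  have "L = diag_mat (\<lambda>a. of_real (Re (L $ a $ a)))"
    using off diag by (auto simp: vec_eq_iff)
  moreover have "C = U ** L ** hconj U"
    unfolding L_def by (simp add: matrix_mul_assoc[symmetric] mult_hconj_cancel[OF UU])
  ultimately show thesis using that[OF UU] by metis
qed

section \<open>Exponentials and determinants\<close>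

lemma conj_diag_mat_nth:
  "(U ** diag_mat e ** hconj U) $ a $ b = (\<Sum>c\<in>UNIV. U $ a $ c * e c * cnj (U $ b $ c))"
  by (subst matrix_matrix_mult_def) (simp add: mult_diag_mat_nth)

lemma conj_diag_mat_mult:
  assumes "hconj U ** U = mat 1"
  shows "(U ** diag_mat d ** hconj U) ** (U ** diag_mat e ** hconj U) = U ** diag_mat (\<lambda>a. d a * e a) ** hconj U"
proof -
  have "(U ** diag_mat d ** hconj U) ** (U ** diag_mat e ** hconj U) = U ** (diag_mat d ** diag_mat e) ** hconj U"
    by (simp add: matrix_mul_assoc[symmetric] mult_hconj_cancel[OF assms])
  then show ?thesis by (simp add: diag_mat_mult)
qed

lemma hconj_conj_diag_mat:
  "hconj (U ** diag_mat d ** hconj U) = U ** diag_mat (\<lambda>a. cnj (d a)) ** hconj U"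
  by (simp add: hconj_mult hconj_diag_mat matrix_mul_assoc)

lemma conj_diag_mat_1:
  assumes "hconj U ** U = mat 1"
  shows "U ** diag_mat (\<lambda>a. 1) ** hconj U = mat 1"
  using mult_hconj_cancel(1)[OF assms] by (simp add: diag_mat_1)

text \<open>Powers of the conjugated diagonal matrix collapse to powers of \<open>d\<close>, so each
  entry of the exponential series is a finite combination of scalar exponential series. This also
  settles the convergence of the series in \<open>mexp\<close>.\<close>

lemma mexp_diagonalizable:
  assumes U: "hconj U ** U = mat 1"
  shows "mexp (U ** diag_mat d ** hconj U) = U ** diag_mat (\<lambda>a. exp (d a)) ** hconj U"
proof -
  define M where "M = U ** diag_mat d ** hconj U"
  have pow: "matpow M k = U ** diag_mat (\<lambda>a. d a ^ k) ** hconj U" for k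
  proof (induction k)
    case 0
    show ?case using mult_hconj_cancel[OF U] by (simp add: diag_mat_1)
  next
    case (Suc k)
    have "matpow M (Suc k) = U ** (diag_mat d ** diag_mat (\<lambda>a. d a ^ k)) ** hconj U"
      unfolding matpow.simps Suc
      by (simp add: M_def matrix_mul_assoc[symmetric] mult_hconj_cancel[OF U])
    then show ?case by (simp add: diag_mat_mult)
  qed
  have "(\<lambda>k. (1 / fact k) *\<^sub>R matpow M k) sums (U ** diag_mat (\<lambda>a. exp (d a)) ** hconj U)"
  proof -
    have "(\<lambda>k. (\<Sum>c\<in>UNIV. U $ a $ c * ((d c) ^ k /\<^sub>R fact k) * cnj (U $ b $ c))) sums
       (\<Sum>c\<in>UNIV. U $ a $ c * exp (d c) * cnj (U $ b $ c))" for a b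
      by (intro sums_sum sums_mult sums_mult2 exp_converges)
    then have *: "(\<lambda>k. ((1 / fact k) *\<^sub>R matpow M k) $ a $ b) sums
       ((U ** diag_mat (\<lambda>a. exp (d a)) ** hconj U) $ a $ b)" for a b
      by (simp add: pow conj_diag_mat_nth scaleR_sum_right divide_inverse_commute)
    show ?thesis
      unfolding sums_def
    proof (intro vec_tendstoI)
      fix a b
      show "(\<lambda>n. (\<Sum>k<n. (1 / fact k) *\<^sub>R matpow M k) $ a $ b) \<longlonglongrightarrow>
         (U ** diag_mat (\<lambda>a. exp (d a)) ** hconj U) $ a $ b"
        using *[of a b] unfolding sums_def by simp
    qed
  qed
  then show ?thesis
    unfolding mexp_def M_def[symmetric] by (rule sums_unique[symmetric])
qed

lemma mexp_diag_mat: "mexp (diag_mat d) = diag_mat (\<lambda>a. exp (d a))"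
  using mexp_diagonalizable[of "mat 1" d] by simp

lemma diagonal_eq_diag_mat: "diagonal A \<Longrightarrow> A = diag_mat (\<lambda>a. A $ a $ a)"
  by (auto simp: diagonal_def vec_eq_iff)

section \<open>Determinants of positive matrices\<close>

lemma hconj_mult_hconj_self:
  fixes E :: "complex^'n^'n"
  shows "hconj (E ** hconj E) = E ** hconj E"
  by (simp add: hconj_mult)

text \<open>Each \<open>d a\<close> is the squared length of a row of \<open>hconj U ** W\<close>,
  hence nonnegative.\<close>

lemma mult_hconj_diagonalizable:
  fixes W :: "complex^'n^'n"
  obtains U and d :: "'n \<Rightarrow> real"
  where "hconj U ** U = mat 1" "W ** hconj W = U ** diag_mat (\<lambda>a. of_real (d a)) ** hconj U" "\<And>a. d a \<ge> 0"
proof -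
  obtain U and d :: "'n \<Rightarrow> real" where U: "hconj U ** U = mat 1"
    and W: "W ** hconj W = U ** diag_mat (\<lambda>a. of_real (d a)) ** hconj U"
    using hermitian_diagonalizable[OF hconj_mult_hconj_self[of W]] by metis
  have "diag_mat (\<lambda>a. of_real (d a)) = hconj U ** (W ** hconj W) ** U"
    using U by (simp add: W matrix_mul_assoc[symmetric] mult_hconj_cancel[OF U])
  also have "\<dots> = (hconj U ** W) ** hconj (hconj U ** W)"
    by (simp add: hconj_mult matrix_mul_assoc)
  finally have *: "diag_mat (\<lambda>a. of_real (d a)) = (hconj U ** W) ** hconj (hconj U ** W)" .
  have "d a \<ge> 0" for a
  proof -
    have "of_real (d a) = ((hconj U ** W) ** hconj (hconj U ** W)) $ a $ a"
      unfolding *[symmetric] by simp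
    also have "\<dots> = of_real (\<Sum>b\<in>UNIV. (cmod ((hconj U ** W) $ a $ b))\<^sup>2)"
      by (subst matrix_matrix_mult_def) (simp add: complex_norm_square del: of_real_power)
    finally have "d a = (\<Sum>b\<in>UNIV. (cmod ((hconj U ** W) $ a $ b))\<^sup>2)"
      using of_real_eq_iff by blast
    then show ?thesis by (simp add: sum_nonneg)
  qed
  then show thesis using that U W by blast
qed

text \<open>The eigenvalues are \<open>1 + d a\<close> with \<open>d a \<ge> 0\<close>. The witness
  \<open>r\<close> records at once that the complex determinant is real and how large it is; the
  later determinant bounds have the same form.\<close>

lemma det_mat_1_plus_mult_hconj:
  fixes W :: "complex^'n^'n"
  shows "\<exists>r\<ge>1. det (mat 1 + W ** hconj W) = of_real r"
proof -
  obtain U and d :: "'n \<Rightarrow> real" where U: "hconj U ** U = mat 1"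
    and W: "W ** hconj W = U ** diag_mat (\<lambda>a. of_real (d a)) ** hconj U" and d: "\<And>a. d a \<ge> 0"
    by (rule mult_hconj_diagonalizable[of W]) blast
  have "mat 1 + W ** hconj W = U ** diag_mat (\<lambda>a. of_real (1 + d a)) ** hconj U"
  proof -
    have "diag_mat (\<lambda>a. of_real (1 + d a)) = mat 1 + diag_mat (\<lambda>a. of_real (d a))"
      by (simp add: diag_mat_1[symmetric] diag_mat_add)
    then show ?thesis
      using mult_hconj_cancel[OF U] by (simp add: W matrix_add_ldistrib matrix_add_rdistrib)
  qed
  then have "det (mat 1 + W ** hconj W) = of_real (\<Prod>a\<in>UNIV. (1 + d a))"
    using U by (simp add: det_unitary_conj det_diag_mat)
  moreover have "(\<Prod>a\<in>UNIV. (1 + d a)) \<ge> 1"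
    by (rule prod_ge_1) (simp add: d)
  ultimately show ?thesis by blast
qed

lemma matrix_inv_ex:
  fixes Q :: "complex^'n^'n"
  assumes "det Q \<noteq> 0"
  obtains Q' where "Q ** Q' = mat 1" "Q' ** Q = mat 1"
  using assms invertible_det_nz[of Q] unfolding invertible_def by blast

text \<open>Adding a positive semidefinite matrix does not decrease the determinant: factoring out
  \<open>Q\<close> leaves \<open>mat 1 + W ** hconj W\<close> with \<open>W\<close> the quotient of
  \<open>Z\<close> by \<open>Q\<close>.\<close>

lemma det_plus_mult_hconj_ge:
  fixes Q Z :: "complex^'n^'n"
  assumes "det Q \<noteq> 0"
  shows "\<exists>r\<ge>(cmod (det Q))\<^sup>2. det (Q ** hconj Q + Z ** hconj Z) = of_real r"
proof -
  obtain Q' where Q': "Q ** Q' = mat 1" "Q' ** Q = mat 1"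
    using matrix_inv_ex[OF assms] .
  define W where "W = Q' ** Z"
  have Z: "Z = Q ** W" by (simp add: W_def matrix_mul_assoc Q')
  have "Q ** hconj Q + Z ** hconj Z = Q ** (mat 1 + W ** hconj W) ** hconj Q"
    unfolding Z by (simp add: hconj_mult matrix_add_ldistrib matrix_add_rdistrib matrix_mul_assoc)
  then have "det (Q ** hconj Q + Z ** hconj Z) = det Q * cnj (det Q) * det (mat 1 + W ** hconj W)"
    by (simp add: det_mul det_hconj)
  moreover obtain r where r: "r \<ge> 1" "det (mat 1 + W ** hconj W) = of_real r"
    using det_mat_1_plus_mult_hconj by blast
  ultimately have "det (Q ** hconj Q + Z ** hconj Z) = of_real ((cmod (det Q))\<^sup>2 * r)"
    by (simp add: complex_norm_square del: of_real_power)
  moreover have "(cmod (det Q))\<^sup>2 * r \<ge> (cmod (det Q))\<^sup>2"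
    using r by (simp add: mult_le_cancel_left1)
  ultimately show ?thesis by blast
qed

lemma det_diag_plus_pos:
  fixes E :: "complex^'n^'n" and l :: "'n \<Rightarrow> real"
  assumes "\<And>a. l a > 0"
  shows "\<exists>r>0. det (diag_mat (\<lambda>a. of_real (l a)) + E ** hconj E) = of_real r"
proof -
  define Q where "Q = diag_mat (\<lambda>a. of_real (sqrt (l a)))"
  have "Q ** hconj Q = diag_mat (\<lambda>a. of_real (l a))"
    using assms by (simp add: Q_def hconj_diag_mat diag_mat_mult of_real_mult[symmetric] less_imp_le
        del: of_real_mult)
  moreover have "det Q \<noteq> 0"
    using assms by (simp add: Q_def det_diag_mat) (metis less_irrefl)
  moreover from this have "(cmod (det Q))\<^sup>2 > 0" by simp
  ultimately show ?thesis
    using det_plus_mult_hconj_ge[of Q E] by (metis less_le_trans)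
qed

text \<open>Midpoint log-convexity of \<open>s \<mapsto> det (\<Lambda> + E\<^sup>s)\<close>. With \<open>M = \<Lambda> + 1\<close> and
  \<open>N = M\<^sup>-\<^sup>1\<^sup>/\<^sup>2 (E - 1) M\<^sup>-\<^sup>1\<^sup>/\<^sup>2\<close>, the matrix \<open>M\<^sup>-\<^sup>1\<^sup>/\<^sup>2 (\<Lambda> + E\<^sup>2) M\<^sup>-\<^sup>1\<^sup>/\<^sup>2\<close> dominates
  \<open>(1 + N)\<^sup>2\<close> because \<open>M\<^sup>-\<^sup>1 \<le> 1\<close>.\<close>

lemma det_diag_plus_midpoint:
  fixes E :: "complex^'n^'n" and l :: "'n \<Rightarrow> real"
  assumes l: "\<And>a. l a > 0" and E: "hconj E = E"
    and nz: "det (diag_mat (\<lambda>a. of_real (l a)) + E) \<noteq> 0"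
  shows "(cmod (det (diag_mat (\<lambda>a. of_real (l a)) + E)))\<^sup>2
    \<le> cmod (det (diag_mat (\<lambda>a. of_real (l a)) + mat 1)) * cmod (det (diag_mat (\<lambda>a. of_real (l a)) + E ** E))"
proof -
  let ?D = "\<lambda>d :: 'n \<Rightarrow> real. diag_mat (\<lambda>a. of_real (d a))"
  define g where "g a = 1 / sqrt (l a + 1)" for a
  define j where "j a = sqrt (1 - 1 / (l a + 1))" for a
  define G J where "G = ?D g" and "J = ?D j"
  define L where "L = ?D l"
  have g2: "g a * g a = 1 / (l a + 1)" "g a * (l a + 1) * g a = 1" for a
    using l[of a] by (simp_all add: g_def field_simps)
  have j2: "j a * j a = 1 - 1 / (l a + 1)" for a
  proof -
    have "1 / (l a + 1) \<le> 1" using l[of a] by (simp add: divide_simps)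
    then show ?thesis by (simp add: j_def)
  qed
  have hG: "hconj G = G" and hJ: "hconj J = J"
    by (simp_all add: G_def J_def hconj_diag_mat)
  have L1: "L + mat 1 = ?D (\<lambda>a. l a + 1)"
    by (simp add: L_def diag_mat_1[symmetric] diag_mat_add)
  have GLG: "G ** L ** G = mat 1 - G ** G"
  proof -
    have "G ** (L + mat 1) ** G = ?D (\<lambda>a. g a * (l a + 1) * g a)"
      unfolding L1 G_def by (simp only: diag_mat_mult of_real_mult)
    then have "G ** (L + mat 1) ** G = mat 1"
      by (simp only: g2 of_real_1 diag_mat_1)
    then show ?thesis
      by (simp add: matrix_add_ldistrib matrix_add_rdistrib algebra_simps)
  qed
  have JJ: "J ** J + G ** G = mat 1"
    by (simp only: J_def G_def diag_mat_mult of_real_mult[symmetric] g2 j2 diag_mat_add of_real_add[symmetric])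
      (simp add: diag_mat_1)
  define N where "N = G ** (E - mat 1) ** G"
  \<comment> \<open>\<open>Z\<close> is chosen so that \<open>Z ** hconj Z\<close> is exactly the
    excess of \<open>G ** (L + E ** E) ** G\<close> over the square of
    \<open>mat 1 + N\<close>.\<close>
  define Z where "Z = G ** (E - mat 1) ** J"
  have hN: "hconj N = N" by (simp add: N_def hconj_mult hconj_diff E hG matrix_mul_assoc)
  have 1: "G ** (L + E) ** G = mat 1 + N"
    by (simp add: N_def matrix_add_ldistrib matrix_add_rdistrib GLG matrix_diff_ldistrib matrix_diff_rdistrib)
  have ZZ: "Z ** hconj Z + N ** N = G ** ((E - mat 1) ** (E - mat 1)) ** G"
  proof -
    have "Z ** hconj Z + N ** N = G ** (E - mat 1) ** (J ** J + G ** G) ** (E - mat 1) ** G"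
      by (simp only: Z_def N_def hconj_mult hconj_diff hconj_mat_1 E hG hJ matrix_add_ldistrib
          matrix_add_rdistrib matrix_mul_assoc)
    then show ?thesis by (simp add: JJ matrix_mul_assoc)
  qed
  have 2: "G ** (L + E ** E) ** G = (mat 1 + N) ** hconj (mat 1 + N) + Z ** hconj Z"
  proof -
    have "(mat 1 + N) ** hconj (mat 1 + N) + Z ** hconj Z = mat 1 + N + N + (Z ** hconj Z + N ** N)"
      by (simp add: hconj_add hN matrix_add_ldistrib matrix_add_rdistrib add_ac)
    also have "\<dots> = mat 1 + N + N + G ** ((E - mat 1) ** (E - mat 1)) ** G"
      by (simp only: ZZ)
    also have "\<dots> = mat 1 + (G ** E ** G - G ** G) + (G ** E ** G - G ** G)
        + (G ** (E ** E) ** G - G ** E ** G - (G ** E ** G - G ** G))"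
      by (simp only: N_def matrix_diff_ldistrib matrix_diff_rdistrib matrix_mul_lid matrix_mul_rid)
    also have "\<dots> = mat 1 - G ** G + G ** (E ** E) ** G"
      by (simp only: diff_conv_add_uminus minus_add_distrib minus_minus) (simp add: add_ac)
    also have "\<dots> = G ** (L + E ** E) ** G"
      by (simp only: matrix_add_ldistrib matrix_add_rdistrib GLG)
    finally show ?thesis ..
  qed
  \<comment> \<open>Used to undo the scaling by \<open>G\<close>: the square of its determinant is
    the reciprocal of \<open>det (L + mat 1)\<close>, which becomes the first factor on the right of
    the claim.\<close>
  have detG: "det G * det G * det (L + mat 1) = 1"
  proof -
    have "det (G ** (L + mat 1) ** G) = det (mat 1 :: complex^'n^'n)"
      by (simp add: matrix_add_ldistrib matrix_add_rdistrib GLG)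
    then show ?thesis by (simp add: det_mul mult_ac)
  qed
  have "det (mat 1 + N) = det G * det G * det (L + E)"
    by (simp add: 1[symmetric] det_mul mult_ac)
  moreover have G0: "det G \<noteq> 0" using detG by auto
  ultimately have "det (mat 1 + N) \<noteq> 0" using nz by (simp add: L_def)
  from det_plus_mult_hconj_ge[OF this, of Z]
  obtain r where r: "r \<ge> (cmod (det (mat 1 + N)))\<^sup>2" "det (G ** (L + E ** E) ** G) = of_real r"
    unfolding 2 by blast
  then have "(cmod (det G * det G * det (L + E)))\<^sup>2 \<le> cmod (det G * det G * det (L + E ** E))"
    unfolding 1[symmetric] by (auto simp: det_mul mult_ac)
  then have *: "(x * x * cmod (det (L + E)))\<^sup>2 \<le> x * x * cmod (det (L + E ** E))" if "x = cmod (det G)" for x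
    by (simp add: that norm_mult)
  define x where "x = cmod (det G)"
  have x: "x > 0" using G0 by (simp add: x_def)
  have y: "cmod (det (L + mat 1)) = 1 / (x * x)"
    using arg_cong[OF detG, of cmod] x by (simp add: norm_mult x_def field_simps)
  have "(x * x) * ((x * x) * (cmod (det (L + E)))\<^sup>2) \<le> (x * x) * cmod (det (L + E ** E))"
    using *[OF x_def] by (simp add: power2_eq_square mult_ac)
  then have "(x * x) * (cmod (det (L + E)))\<^sup>2 \<le> cmod (det (L + E ** E))"
    using x by (metis mult_le_cancel_left_pos mult_pos_pos)
  then show ?thesis
    unfolding L_def[symmetric] y using x by (simp add: field_simps)
qed

section \<open>Convexity and the softplus transform\<close>

text \<open>Repeated halving shows that the difference quotients of \<psi> at 0 with steps
  \<open>1 / 2 ^ n\<close> are at most \<psi>(1) - \<psi>(0); their limit is \<open>D\<close>. Only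
  midpoints of segments starting at 0 occur in this argument.\<close>

lemma midpoint_convex_tangent:
  fixes \<psi> :: "real \<Rightarrow> real"
  assumes mid: "\<And>s. 2 * \<psi> (s / 2) \<le> \<psi> 0 + \<psi> s"
    and der: "(\<psi> has_real_derivative D) (at 0)"
  shows "\<psi> 0 + D \<le> \<psi> 1"
proof -
  have *: "(\<psi> (1 / 2 ^ n) - \<psi> 0) / (1 / 2 ^ n) \<le> \<psi> 1 - \<psi> 0" for n
  proof (induction n)
    case (Suc n)
    have "2 * \<psi> (1 / 2 ^ Suc n) \<le> \<psi> 0 + \<psi> (1 / 2 ^ n)"
      using mid[of "1 / 2 ^ n"] by (simp add: mult.commute)
    then have "2 * (\<psi> (1 / 2 ^ Suc n) - \<psi> 0) \<le> \<psi> (1 / 2 ^ n) - \<psi> 0" by simp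
    then have "2 ^ n * (2 * (\<psi> (1 / 2 ^ Suc n) - \<psi> 0)) \<le> 2 ^ n * (\<psi> (1 / 2 ^ n) - \<psi> 0)"
      by (intro mult_left_mono) auto
    also have "\<dots> \<le> \<psi> 1 - \<psi> 0" using Suc by (simp add: mult.commute)
    finally show ?case by (simp add: algebra_simps)
  qed simp
  have "(\<lambda>n. 1 / 2 ^ n :: real) \<longlonglongrightarrow> 0"
    using LIMSEQ_realpow_zero[of "1/2"] by (simp add: power_one_over)
  then have "filterlim (\<lambda>n. 1 / 2 ^ n :: real) (at 0) sequentially"
    by (simp add: filterlim_at)
  then have "(\<lambda>n. (\<psi> (1 / 2 ^ n) - \<psi> 0) / (1 / 2 ^ n)) \<longlonglongrightarrow> D"
    using der filterlim_compose[of "\<lambda>h. (\<psi> h - \<psi> 0) / h"] unfolding DERIV_def by fastforce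
  then have "D \<le> \<psi> 1 - \<psi> 0"
    by (rule LIMSEQ_le_const2) (use * in blast)
  then show ?thesis by simp
qed

text \<open>Jacobi's formula at a diagonal point. A permutation other than the identity moves at
  least two indices, so after one factor of its Leibniz term is differentiated an off-diagonal zero
  remains.\<close>

lemma det_has_field_derivative_diag:
  fixes M :: "complex \<Rightarrow> complex^'n^'n"
  assumes M: "\<And>a b. ((\<lambda>z. M z $ a $ b) has_field_derivative M' $ a $ b) (at z0)"
    and M0: "M z0 = diag_mat m" and m: "\<And>a. m a \<noteq> 0"
  shows "((\<lambda>z. det (M z)) has_field_derivative (det (M z0) * (\<Sum>a\<in>UNIV. M' $ a $ a / m a))) (at z0)"
proof -
  let ?P = "{p. p permutes (UNIV :: 'n set)}"
  have "((\<lambda>z. det (M z)) has_field_derivative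
     (\<Sum>p\<in>?P. of_int (sign p) * (\<Sum>a\<in>UNIV. M' $ a $ p a * (\<Prod>b\<in>UNIV - {a}. M z0 $ b $ p b)))) (at z0)"
    unfolding det_def by (intro DERIV_sum DERIV_cmult has_field_derivative_prod M)
  moreover have "(\<Sum>p\<in>?P. of_int (sign p) * (\<Sum>a\<in>UNIV. M' $ a $ p a * (\<Prod>b\<in>UNIV - {a}. M z0 $ b $ p b)))
      = (\<Sum>p\<in>{id}. of_int (sign p) * (\<Sum>a\<in>UNIV. M' $ a $ p a * (\<Prod>b\<in>UNIV - {a}. M z0 $ b $ p b)))"
  proof (rule sum.mono_neutral_right)
    show "\<forall>p\<in>?P - {id}. of_int (sign p) * (\<Sum>a\<in>UNIV. M' $ a $ p a * (\<Prod>b\<in>UNIV - {a}. M z0 $ b $ p b)) = 0"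
    proof
      fix p assume p: "p \<in> ?P - {id}"
      then have inj: "inj p" by (auto intro: permutes_inj)
      from p obtain x where x: "p x \<noteq> x" by (auto simp: fun_eq_iff)
      then have px: "p (p x) \<noteq> p x" using inj by (auto dest: injD)
      have "(\<Prod>b\<in>UNIV - {a}. M z0 $ b $ p b) = 0" for a
      proof (rule prod_zero)
        show "\<exists>b\<in>UNIV - {a}. M z0 $ b $ p b = 0"
          using x px by (cases "a = x") (auto simp: M0 intro: bexI[of _ "p x"] bexI[of _ x])
      qed simp
      then show "of_int (sign p) * (\<Sum>a\<in>UNIV. M' $ a $ p a * (\<Prod>b\<in>UNIV - {a}. M z0 $ b $ p b)) = 0"
        by (simp only: mult_zero_right sum.neutral_const)
    qed
  qed (auto simp: permutes_id)
  moreover have "(\<Prod>b\<in>UNIV - {a}. M z0 $ b $ b) = det (M z0) / m a" for a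
    using m prod.remove[of UNIV a m] by (simp add: M0 det_diag_mat)
  ultimately show ?thesis by (simp add: sign_id sum_distrib_left mult_ac)
qed

section \<open>The softplus function and its integral\<close>

definition softplus :: "real \<Rightarrow> real" where
  "softplus x = ln (1 + exp x)"

lemma softplus_pos: "softplus x > 0"
  unfolding softplus_def by (rule ln_gt_zero) simp

lemma softplus_le_exp: "softplus x \<le> exp x"
  unfolding softplus_def by (rule ln_add_one_self_le_self) simp

lemma softplus_minus: "softplus (- x) = softplus x - x"
proof -
  have "1 + exp (-x) = (1 + exp x) / exp x" by (simp add: exp_minus field_simps)
  then show ?thesis using add_pos_pos[of 1 "exp x"] by (simp add: softplus_def ln_div)
qed

lemma DERIV_softplus [derivative_intros]:
  assumes "(g has_real_derivative g') (at x within S)"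
  shows "((\<lambda>x. softplus (g x)) has_real_derivative (exp (g x) / (1 + exp (g x)) * g')) (at x within S)"
  unfolding softplus_def
  by (rule derivative_eq_intros assms refl | simp add: add_pos_pos)+

lemma softplus_antiderivative:
  obtains \<Phi> where "\<And>x. (\<Phi> has_real_derivative softplus x) (at x)"
proof -
  have "isCont softplus x" for x
    using DERIV_isCont[OF DERIV_softplus[OF DERIV_ident]] by simp
  then have "\<exists>F. \<forall>x. (-\<infinity>::ereal) < ereal x \<longrightarrow> ereal x < \<infinity> \<longrightarrow> (F has_vector_derivative softplus x) (at x)"
    by (intro einterval_antiderivative) auto
  then show thesis
    using that by (auto simp: has_real_derivative_iff_has_vector_derivative)
qed

text \<open>Since \<open>\<integral> softplus (x + u) du\<close> is, up to divergent affine terms in \<open>x\<close>, equal to \<open>x\<^sup>2 / 2\<close>,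
  tangent inequalities for all translates of softplus integrate to one for the square.\<close>

lemma square_tangent_from_softplus:
  fixes a b c :: "'n::finite \<Rightarrow> real"
  assumes tangent: "\<And>u. (\<Sum>i\<in>UNIV. softplus (a i + u) + exp (a i + u) / (1 + exp (a i + u)) * b i)
      \<le> (\<Sum>i\<in>UNIV. softplus (c i + u))"
    and sum: "(\<Sum>i\<in>UNIV. c i) = (\<Sum>i\<in>UNIV. a i) + (\<Sum>i\<in>UNIV. b i)"
  shows "(\<Sum>i\<in>UNIV. (a i)\<^sup>2) + 2 * (\<Sum>i\<in>UNIV. a i * b i) \<le> (\<Sum>i\<in>UNIV. (c i)\<^sup>2)"
proof -
  obtain \<Phi> where \<Phi>: "\<And>x. (\<Phi> has_real_derivative softplus x) (at x)"
    by (rule softplus_antiderivative) blast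
  have \<Phi>': "((\<lambda>u. \<Phi> (g u)) has_real_derivative softplus (g u) * g') (at u)"
    if "(g has_real_derivative g') (at u)" for g g' u
    using DERIV_chain2[OF \<Phi> that] .
  \<comment> \<open>The source of the square: \<open>softplus x - softplus (- x) = x\<close>, so the
    even part of an antiderivative is quadratic.\<close>
  have refl: "\<Phi> x + \<Phi> (- x) = x\<^sup>2 / 2 + 2 * \<Phi> 0" for x
  proof -
    have "((\<lambda>x. \<Phi> x + \<Phi> (- x) - x\<^sup>2 / 2) has_real_derivative 0) (at x)" for x
      by (rule derivative_eq_intros \<Phi>' refl | simp add: softplus_minus)+
    then have "(\<lambda>x. \<Phi> x + \<Phi> (- x) - x\<^sup>2 / 2) x = (\<lambda>x. \<Phi> x + \<Phi> (- x) - x\<^sup>2 / 2) 0"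
      by (intro DERIV_isconst_all) auto
    then show ?thesis by simp
  qed
  \<comment> \<open>Softplus lies between 0 and \<open>exp\<close>, so differences of \<Phi> are
    controlled by differences of \<open>exp\<close> and vanish far to the left.\<close>
  have bound: "\<bar>\<Phi> x - \<Phi> y\<bar> \<le> \<bar>exp x - exp y\<bar>" for x y
  proof -
    have le: "\<Phi> x \<le> \<Phi> y \<and> \<Phi> y - \<Phi> x \<le> exp y - exp x" if "x \<le> y" for x y
    proof
      show "\<Phi> x \<le> \<Phi> y"
        by (rule DERIV_nonneg_imp_nondecreasing[OF that]) (use \<Phi> softplus_pos less_imp_le in blast)
      have "(\<lambda>x. exp x - \<Phi> x) x \<le> (\<lambda>x. exp x - \<Phi> x) y"
      proof (rule DERIV_nonneg_imp_nondecreasing[OF that])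
        fix z
        have "((\<lambda>x. exp x - \<Phi> x) has_real_derivative exp z - softplus z) (at z)"
          by (intro DERIV_diff DERIV_exp \<Phi>)
        then show "\<exists>d. ((\<lambda>x. exp x - \<Phi> x) has_real_derivative d) (at z) \<and> 0 \<le> d"
          using softplus_le_exp[of z] by force
      qed
      then show "\<Phi> y - \<Phi> x \<le> exp y - exp x" by simp
    qed
    show ?thesis using le[of x y] le[of y x] by (cases "x \<le> y") (auto simp: abs_if)
  qed
  have exp0: "((\<lambda>u. exp (x - u)) \<longlongrightarrow> 0) at_top" for x :: real
  proof (rule filterlim_compose[OF exp_at_bot])
    show "filterlim (\<lambda>u. x - u) at_bot at_top"
      unfolding filterlim_at_bot eventually_at_top_linorder
      by (metis add.commute diff_le_eq le_diff_eq)
  qed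
  have d0: "((\<lambda>u. \<Phi> (x - u) - \<Phi> (y - u)) \<longlongrightarrow> 0) at_top" for x y
  proof (rule Lim_null_comparison)
    show "\<forall>\<^sub>F u in at_top. norm (\<Phi> (x - u) - \<Phi> (y - u)) \<le> \<bar>exp (x - u) - exp (y - u)\<bar>"
      using bound by simp
    show "((\<lambda>u. \<bar>exp (x - u) - exp (y - u)\<bar>) \<longlongrightarrow> 0) at_top"
      using tendsto_rabs[OF tendsto_diff[OF exp0[of x] exp0[of y]]] by simp
  qed
  have s0: "((\<lambda>u. softplus (x - u)) \<longlongrightarrow> 0) at_top" for x
  proof (rule Lim_null_comparison[OF _ exp0[of x]])
    show "\<forall>\<^sub>F u in at_top. norm (softplus (x - u)) \<le> exp (x - u)"
      using softplus_pos[THEN less_imp_le] softplus_le_exp by simp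
  qed
  \<comment> \<open>\<Theta> is an antiderivative in \<open>u\<close> of the gap in
    \<open>tangent\<close>. It is nondecreasing, tends to 0 at minus infinity and to
    \<open>Q\<close> at plus infinity, whence \<open>0 \<le> Q\<close>.\<close>
  define \<Theta> where "\<Theta> u = (\<Sum>i\<in>UNIV. \<Phi> (c i + u) - \<Phi> (a i + u) - softplus (a i + u) * b i)" for u
  have mono: "\<Theta> x \<le> \<Theta> y" if "x \<le> y" for x y
  proof (rule DERIV_nonneg_imp_nondecreasing[OF that])
    fix u
    have "(\<Theta> has_real_derivative (\<Sum>i\<in>UNIV. softplus (c i + u) - softplus (a i + u)
        - exp (a i + u) / (1 + exp (a i + u)) * b i)) (at u)"
      unfolding \<Theta>_def by (rule derivative_eq_intros \<Phi>' refl | simp)+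
    moreover have "0 \<le> (\<Sum>i\<in>UNIV. softplus (c i + u) - softplus (a i + u)
        - exp (a i + u) / (1 + exp (a i + u)) * b i)"
      using tangent[of u] by (simp add: sum_subtractf sum.distrib)
    ultimately show "\<exists>d. (\<Theta> has_real_derivative d) (at u) \<and> 0 \<le> d" by blast
  qed
  define Q where "Q = (\<Sum>i\<in>UNIV. ((c i)\<^sup>2 - (a i)\<^sup>2) / 2 - a i * b i)"
  have "((\<lambda>u. (\<Sum>i\<in>UNIV. \<Phi> (c i - u) - \<Phi> (a i - u) - softplus (a i - u) * b i)) \<longlongrightarrow>
      (\<Sum>i\<in>(UNIV :: 'n set). 0 - 0 * b i)) at_top"
    by (intro tendsto_intros d0 s0)
  then have lim1: "((\<lambda>u. \<Theta> (- u)) \<longlongrightarrow> 0) at_top"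
    by (simp add: \<Theta>_def)
  \<comment> \<open>Reflection carries the behaviour at plus infinity to the left end, where
    differences vanish. The terms linear in \<open>u\<close> have total coefficient zero by
    \<open>sum\<close>.\<close>
  have \<Theta>: "\<Theta> u = Q - (\<Sum>i\<in>UNIV. (\<Phi> (- c i - u) - \<Phi> (- a i - u)) + softplus (- a i - u) * b i)" for u
  proof -
    have "\<Phi> (c i + u) - \<Phi> (a i + u) - softplus (a i + u) * b i =
       ((c i)\<^sup>2 - (a i)\<^sup>2) / 2 - a i * b i + u * (c i - a i - b i)
       - ((\<Phi> (- c i - u) - \<Phi> (- a i - u)) + softplus (- a i - u) * b i)" for i
    proof -
      have "softplus (a i + u) = softplus (- a i - u) + (a i + u)"
        using softplus_minus[of "a i + u"] by simp
      moreover have "\<Phi> (c i + u) = (c i + u)\<^sup>2 / 2 + 2 * \<Phi> 0 - \<Phi> (- c i - u)"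
        using refl[of "c i + u"] by simp
      moreover have "\<Phi> (a i + u) = (a i + u)\<^sup>2 / 2 + 2 * \<Phi> 0 - \<Phi> (- a i - u)"
        using refl[of "a i + u"] by simp
      ultimately show ?thesis by (simp add: power2_eq_square field_simps)
    qed
    then have "\<Theta> u = Q + u * (\<Sum>i\<in>UNIV. c i - a i - b i)
       - (\<Sum>i\<in>UNIV. (\<Phi> (- c i - u) - \<Phi> (- a i - u)) + softplus (- a i - u) * b i)"
      unfolding \<Theta>_def Q_def sum_distrib_left by (simp only: sum.distrib sum_subtractf)
    then show ?thesis using sum by (simp add: sum_subtractf)
  qed
  have "((\<lambda>u. Q - (\<Sum>i\<in>UNIV. (\<Phi> (- c i - u) - \<Phi> (- a i - u)) + softplus (- a i - u) * b i)) \<longlongrightarrow>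
      Q - (\<Sum>i\<in>(UNIV :: 'n set). 0 + 0 * b i)) at_top"
    by (intro tendsto_intros d0 s0)
  then have lim2: "(\<Theta> \<longlongrightarrow> Q) at_top"
    unfolding \<Theta>[symmetric] by simp
  have "0 \<le> Q"
    by (rule tendsto_le[OF _ lim2 lim1])
      (auto simp: eventually_at_top_linorder intro!: exI[of _ 0] mono)
  then show ?thesis
    by (simp add: Q_def sum_subtractf sum_divide_distrib[symmetric])
qed

section \<open>The comparison inequality for geodesic triangles\<close>

lemma norm_hermitian_conj_diag:
  fixes U :: "complex^'n^'n" and c :: "'n \<Rightarrow> real"
  assumes "hconj U ** U = mat 1"
  shows "(norm (U ** diag_mat (\<lambda>a. of_real (c a)) ** hconj U))\<^sup>2 = (\<Sum>a\<in>UNIV. (c a)\<^sup>2)"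
proof -
  let ?C = "U ** diag_mat (\<lambda>a. of_real (c a)) ** hconj U"
  have "complex_of_real ((norm ?C)\<^sup>2) = trace (hconj ?C ** ?C)"
    by (rule trace_hconj_mult[symmetric])
  also have "\<dots> = trace (U ** diag_mat (\<lambda>a. of_real ((c a)\<^sup>2)) ** hconj U)"
    by (simp add: hconj_conj_diag_mat conj_diag_mat_mult[OF assms] power2_eq_square)
  also have "\<dots> = of_real (\<Sum>a\<in>UNIV. (c a)\<^sup>2)"
    by (simp add: trace_unitary_conj[OF assms] trace_diag_mat)
  finally show ?thesis using of_real_eq_iff by blast
qed

text \<open>The tangent at \<open>s = 0\<close>, read at \<open>s = 1\<close>, of the convex
  function \<open>s \<mapsto> ln det (L + e^(s B))\<close>, where \<open>L\<close> is the diagonal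
  matrix of \<open>l\<close>. Jacobi's formula gives the slope, as the matrix is diagonal at
  \<open>s = 0\<close>.\<close>

lemma ln_det_diag_plus_mexp_tangent:
  fixes B :: "complex^'n^'n" and l :: "'n \<Rightarrow> real"
  assumes l: "\<And>a. l a > 0" and B: "hconj B = B"
  shows "det (diag_mat (\<lambda>a. of_real (l a)) + mexp B) \<noteq> 0"
    "(\<Sum>a\<in>UNIV. ln (l a + 1) + Re (B $ a $ a) / (l a + 1)) \<le> ln (cmod (det (diag_mat (\<lambda>a. of_real (l a)) + mexp B)))"
proof -
  obtain W and b :: "'n \<Rightarrow> real" where W: "hconj W ** W = mat 1"
    and Bd: "B = W ** diag_mat (\<lambda>a. of_real (b a)) ** hconj W"
    using hermitian_diagonalizable[OF B] by metis
  define L where "L = diag_mat (\<lambda>a. complex_of_real (l a))"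
  \<comment> \<open>The complex parameter makes the field derivative of the determinant available.
    On the real line \<open>E\<close> is Hermitian and the value at \<open>s\<close> is the square
    of the value at \<open>s / 2\<close>, which yields positivity and the midpoint bound.\<close>
  define E where "E z = W ** diag_mat (\<lambda>a. exp (z * of_real (b a))) ** hconj W" for z :: complex
  have E0: "E 0 = mat 1" using conj_diag_mat_1[OF W] by (simp add: E_def)
  have E1: "E 1 = mexp B" unfolding Bd mexp_diagonalizable[OF W] by (simp add: E_def)
  have EE: "E (of_real (s / 2)) ** E (of_real (s / 2)) = E (of_real s)" for s
    by (simp add: E_def conj_diag_mat_mult[OF W] exp_add[symmetric])
  have hE: "hconj (E (of_real s)) = E (of_real s)" for s
    by (simp add: E_def hconj_conj_diag_mat exp_cnj)
  have pos: "\<exists>r>0. det (L + E (of_real s)) = of_real r" for s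
    using det_diag_plus_pos[where l = l, OF l, where E = "E (of_real (s / 2))"] unfolding hE EE L_def .
  define \<psi> where "\<psi> s = ln (Re (det (L + E (of_real s))))" for s
  have cmod: "cmod (det (L + E (of_real s))) = Re (det (L + E (of_real s)))"
    "Re (det (L + E (of_real s))) > 0" for s
    using pos[of s] by auto
  have L1: "L + mat 1 = diag_mat (\<lambda>a. of_real (l a + 1))"
    by (simp add: L_def diag_mat_1[symmetric] diag_mat_add)
  have mid: "2 * \<psi> (s / 2) \<le> \<psi> 0 + \<psi> s" for s
  proof -
    let ?p = "\<lambda>s. Re (det (L + E (of_real s)))"
    have "det (L + E (of_real (s / 2))) \<noteq> 0" using cmod(2)[of "s / 2"] by auto
    then have "(?p (s / 2))\<^sup>2 \<le> ?p 0 * ?p s"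
      using det_diag_plus_midpoint[where l = l, OF l hE[of "s / 2"]] cmod[of "s / 2"] cmod[of 0] cmod[of s]
      unfolding EE L_def[symmetric] by (auto simp: E0)
    then have "ln ((?p (s / 2))\<^sup>2) \<le> ln (?p 0 * ?p s)"
      using cmod(2)[of "s / 2"] by (intro ln_mono) (auto simp: zero_less_power)
    then show ?thesis
      using cmod(2)[of 0] cmod(2)[of s] cmod(2)[of "s / 2"]
      unfolding \<psi>_def by (simp add: ln_realpow ln_mult_pos)
  qed
  have dE: "((\<lambda>z. (L + E z) $ i $ j) has_field_derivative B $ i $ j) (at 0)" for i j
    unfolding E_def Bd vector_add_component conj_diag_mat_nth
    by (rule derivative_eq_intros refl | simp add: mult_ac)+
  have "((\<lambda>z. det (L + E z)) has_field_derivative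
      (det (L + E 0) * (\<Sum>a\<in>UNIV. B $ a $ a / of_real (l a + 1)))) (at 0)"
  proof (rule det_has_field_derivative_diag[OF dE])
    show "L + E 0 = diag_mat (\<lambda>a. of_real (l a + 1))" by (simp add: E0 L1)
    show "complex_of_real (l a + 1) \<noteq> 0" for a
      unfolding of_real_eq_0_iff using l[of a] by linarith
  qed
  then have "((\<lambda>s. det (L + E (of_real s))) has_vector_derivative
      (det (L + E 0) * (\<Sum>a\<in>UNIV. B $ a $ a / of_real (l a + 1)))) (at 0)"
    using has_vector_derivative_real_field[of "\<lambda>z. det (L + E z)" _ 0] by simp
  from bounded_linear.has_vector_derivative[OF bounded_linear_Re this]
  have "((\<lambda>s. Re (det (L + E (of_real s)))) has_real_derivative
      Re (det (L + E 0) * (\<Sum>a\<in>UNIV. B $ a $ a / of_real (l a + 1)))) (at 0)"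
    by (simp add: has_real_derivative_iff_has_vector_derivative)
  then have "(\<psi> has_real_derivative (1 / Re (det (L + E (of_real 0))) *
      Re (det (L + E 0) * (\<Sum>a\<in>UNIV. B $ a $ a / of_real (l a + 1))))) (at 0)"
    unfolding \<psi>_def using cmod(2)[of 0] by (intro DERIV_chain'[OF _ DERIV_ln_divide]) auto
  moreover have "1 / Re (det (L + E (of_real 0))) *
      Re (det (L + E 0) * (\<Sum>a\<in>UNIV. B $ a $ a / of_real (l a + 1))) = (\<Sum>a\<in>UNIV. Re (B $ a $ a) / (l a + 1))"
  proof -
    obtain r where r: "r > 0" "det (L + E 0) = of_real r" using pos[of 0] by auto
    have "Re (of_real r * (\<Sum>a\<in>UNIV. B $ a $ a / of_real (l a + 1))) = r * (\<Sum>a\<in>UNIV. Re (B $ a $ a) / (l a + 1))"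
      by (simp add: Re_divide_of_real del: of_real_add)
    then show ?thesis using r by simp
  qed
  ultimately have "\<psi> 0 + (\<Sum>a\<in>UNIV. Re (B $ a $ a) / (l a + 1)) \<le> \<psi> 1"
    using midpoint_convex_tangent[of \<psi>, OF mid] by metis
  moreover have "\<psi> 0 = (\<Sum>a\<in>UNIV. ln (l a + 1))"
  proof -
    have "l a + 1 \<noteq> 0" for a using l[of a] by linarith
    moreover have "\<psi> 0 = ln (\<Prod>a\<in>UNIV. l a + 1)"
      unfolding \<psi>_def by (simp add: E0 L1 det_diag_mat of_real_prod[symmetric] del: of_real_add of_real_prod)
    ultimately show ?thesis by (simp add: ln_prod)
  qed
  moreover have "\<psi> 1 = ln (cmod (det (L + mexp B)))"
    using cmod(1)[of 1] by (simp add: \<psi>_def E1)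
  ultimately show "(\<Sum>a\<in>UNIV. ln (l a + 1) + Re (B $ a $ a) / (l a + 1))
      \<le> ln (cmod (det (diag_mat (\<lambda>a. of_real (l a)) + mexp B)))"
    by (simp add: sum.distrib L_def)
  show "det (diag_mat (\<lambda>a. of_real (l a)) + mexp B) \<noteq> 0"
    using cmod(2)[of 1] by (auto simp: E1 L_def)
qed

text \<open>The geodesic triangle with vertices \<open>1\<close>, \<open>e\<^sup>A\<close>, \<open>e\<^sup>C\<close>: a consequence of nonpositive curvature.\<close>

lemma mexp_hermitian_distance_tangent:
  fixes B C :: "complex^'n^'n" and \<alpha> :: "'n \<Rightarrow> real"
  assumes B: "hconj B = B" and C: "hconj C = C"
    and trB: "trace B = 0" and trC: "trace C = 0" and tr\<alpha>: "(\<Sum>a\<in>UNIV. \<alpha> a) = 0"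
    and eq: "mexp C = diag_mat (\<lambda>a. of_real (exp (\<alpha> a / 2))) ** mexp B ** diag_mat (\<lambda>a. of_real (exp (\<alpha> a / 2)))"
  shows "(\<Sum>a\<in>UNIV. (\<alpha> a)\<^sup>2) + 2 * (\<Sum>a\<in>UNIV. \<alpha> a * Re (B $ a $ a)) \<le> (norm C)\<^sup>2"
proof -
  obtain V and c :: "'n \<Rightarrow> real" where V: "hconj V ** V = mat 1"
    and Cd: "C = V ** diag_mat (\<lambda>a. of_real (c a)) ** hconj V"
    using hermitian_diagonalizable[OF C] by metis
  have normC: "(norm C)\<^sup>2 = (\<Sum>a\<in>UNIV. (c a)\<^sup>2)"
    unfolding Cd by (rule norm_hermitian_conj_diag[OF V])
  have "of_real (\<Sum>a\<in>UNIV. c a) = trace C"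
    unfolding Cd trace_unitary_conj[OF V] by (simp add: trace_diag_mat)
  then have sc: "(\<Sum>a\<in>UNIV. c a) = 0" using trC of_real_eq_0_iff by metis
  have "(\<Sum>a\<in>UNIV. Re (B $ a $ a)) = Re (trace B)" by (simp add: trace_def)
  then have sb: "(\<Sum>a\<in>UNIV. Re (B $ a $ a)) = 0" using trB by simp
  have "(\<Sum>a\<in>UNIV. softplus (\<alpha> a + u) + exp (\<alpha> a + u) / (1 + exp (\<alpha> a + u)) * Re (B $ a $ a))
      \<le> (\<Sum>a\<in>UNIV. softplus (c a + u))" for u
  proof -
    \<comment> \<open>With these choices \<open>T ** L ** T = mat 1\<close>, and
      \<open>T ** mexp B ** T\<close> is \<open>mexp C\<close> scaled by \<open>exp u\<close>. The
      logarithm of the determinant of \<open>T ** (L + mexp B) ** T\<close> is therefore the sum of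
      \<open>softplus (c a + u)\<close> over the eigenvalues of \<open>C\<close>.\<close>
    define l where "l a = exp (- (\<alpha> a + u))" for a
    define L where "L = diag_mat (\<lambda>a. complex_of_real (l a))"
    define T where "T = diag_mat (\<lambda>a. complex_of_real (exp ((\<alpha> a + u) / 2)))"
    note tangent = ln_det_diag_plus_mexp_tangent[of l, OF _ B, folded L_def]
    have TLT: "T ** L ** T = mat 1"
      by (simp add: T_def L_def l_def diag_mat_mult diag_mat_1[symmetric] exp_of_real[symmetric]
          exp_add[symmetric] field_simps)
    have TBT: "T ** mexp B ** T = V ** diag_mat (\<lambda>a. of_real (exp (c a + u))) ** hconj V"
    proof -
      define S where "S = diag_mat (\<lambda>a::'n. complex_of_real (exp (u / 2)))"
      define G where "G = diag_mat (\<lambda>a. complex_of_real (exp (\<alpha> a / 2)))"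
      have S: "S ** M = M ** S" for M
        by (simp add: vec_eq_iff S_def diag_mat_mult_nth mult_diag_mat_nth mult.commute)
      have T1: "T = S ** G" "T = G ** S"
        by (simp_all add: T_def S_def G_def diag_mat_mult exp_add[symmetric] of_real_mult[symmetric]
            add_divide_distrib add.commute del: of_real_mult)
      let ?D = "diag_mat (\<lambda>a. complex_of_real (exp (c a)))"
      have "T ** mexp B ** T = (S ** G) ** mexp B ** (G ** S)"
        by (simp only: T1[symmetric])
      also have "\<dots> = S ** mexp C ** S"
        by (simp only: eq G_def[symmetric] matrix_mul_assoc)
      also have "\<dots> = (S ** V) ** ?D ** (hconj V ** S)"
        unfolding Cd mexp_diagonalizable[OF V] exp_of_real by (simp only: matrix_mul_assoc)
      also have "\<dots> = (V ** S) ** ?D ** (S ** hconj V)"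
        by (simp only: S[of V] S[of "hconj V"])
      also have "\<dots> = V ** (S ** ?D ** S) ** hconj V"
        by (simp only: matrix_mul_assoc)
      also have "S ** diag_mat (\<lambda>a. of_real (exp (c a))) ** S = diag_mat (\<lambda>a. of_real (exp (c a + u)))"
        by (simp add: S_def diag_mat_mult exp_add[symmetric] of_real_mult[symmetric] add.commute del: of_real_mult)
      finally show ?thesis .
    qed
    have "T ** (L + mexp B) ** T = V ** diag_mat (\<lambda>a. of_real (1 + exp (c a + u))) ** hconj V"
    proof -
      have "diag_mat (\<lambda>a. complex_of_real (1 + exp (c a + u))) = mat 1 + diag_mat (\<lambda>a. of_real (exp (c a + u)))"
        by (simp add: diag_mat_1[symmetric] diag_mat_add)
      then show ?thesis
        using mult_hconj_cancel(1)[OF V]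
        by (simp add: matrix_add_ldistrib matrix_add_rdistrib TLT TBT)
    qed
    then have "det (T ** (L + mexp B) ** T) = of_real (\<Prod>a\<in>UNIV. 1 + exp (c a + u))"
      by (simp add: det_unitary_conj[OF V] det_diag_mat)
    then have "det T * det T * det (L + mexp B) = of_real (\<Prod>a\<in>UNIV. 1 + exp (c a + u))"
      by (simp add: det_mul mult_ac)
    moreover have "det T * det T = of_real (\<Prod>a\<in>UNIV. exp (\<alpha> a + u))"
      by (simp add: T_def det_diag_mat prod.distrib[symmetric] exp_of_real[symmetric] exp_add[symmetric])
    ultimately have "(\<Prod>a\<in>UNIV. exp (\<alpha> a + u)) * cmod (det (L + mexp B)) = (\<Prod>a\<in>UNIV. 1 + exp (c a + u))"
    proof -
      assume "det T * det T = of_real (\<Prod>a\<in>UNIV. exp (\<alpha> a + u))"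
        and "det T * det T * det (L + mexp B) = of_real (\<Prod>a\<in>UNIV. 1 + exp (c a + u))"
      then have "of_real (\<Prod>a\<in>UNIV. exp (\<alpha> a + u)) * det (L + mexp B) = of_real (\<Prod>a\<in>UNIV. 1 + exp (c a + u))"
        by simp
      then have "\<bar>\<Prod>a\<in>UNIV. exp (\<alpha> a + u)\<bar> * cmod (det (L + mexp B)) = \<bar>\<Prod>a\<in>UNIV. 1 + exp (c a + u)\<bar>"
        by (metis norm_mult norm_of_real)
      then show ?thesis by (simp add: abs_prod add_nonneg_nonneg)
    qed
    moreover have "1 + exp x \<noteq> 0" for x :: real
      using add_pos_pos[of 1 "exp x"] by simp
    ultimately have "ln ((\<Prod>a\<in>UNIV. exp (\<alpha> a + u)) * cmod (det (L + mexp B))) = (\<Sum>a\<in>UNIV. softplus (c a + u))"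
      by (simp add: softplus_def ln_prod)
    moreover have "ln ((\<Prod>a\<in>UNIV. exp (\<alpha> a + u)) * cmod (det (L + mexp B)))
        = (\<Sum>a\<in>UNIV. \<alpha> a + u) + ln (cmod (det (L + mexp B)))"
    proof -
      have "cmod (det (L + mexp B)) > 0" using tangent(1) by (simp add: l_def)
      then show ?thesis by (simp add: ln_mult_pos prod_pos exp_sum[symmetric])
    qed
    \<comment> \<open>By \<open>softplus_minus\<close>, \<open>ln (1 + exp (- x))\<close> equals
      \<open>softplus x - x\<close>; the square of \<open>det T\<close> supplies the missing
      \<open>x = \<alpha> a + u\<close>.\<close>
    moreover have "(\<Sum>a\<in>UNIV. \<alpha> a + u) + (\<Sum>a\<in>UNIV. ln (l a + 1) + Re (B $ a $ a) / (l a + 1)) =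
       (\<Sum>a\<in>UNIV. softplus (\<alpha> a + u) + exp (\<alpha> a + u) / (1 + exp (\<alpha> a + u)) * Re (B $ a $ a))"
      unfolding sum.distrib[symmetric]
    proof (rule sum.cong[OF refl])
      fix a
      have "ln (l a + 1) = softplus (\<alpha> a + u) - (\<alpha> a + u)"
        using softplus_minus[of "\<alpha> a + u"] by (simp add: softplus_def l_def add.commute)
      moreover have "1 / (l a + 1) = exp (\<alpha> a + u) / (1 + exp (\<alpha> a + u))"
      proof -
        have "l a = 1 / exp (\<alpha> a + u)" unfolding l_def exp_minus divide_inverse by simp
        moreover have "1 + exp (\<alpha> a + u) \<noteq> 0" "exp (\<alpha> a + u) \<noteq> 0"
          using add_pos_pos[of 1 "exp (\<alpha> a + u)"] by auto
        moreover have "1 + l a \<noteq> 0" using add_pos_pos[of 1 "l a"] by (simp add: l_def)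
        ultimately show ?thesis by (simp add: field_simps)
      qed
      then have "Re (B $ a $ a) / (l a + 1) = exp (\<alpha> a + u) / (1 + exp (\<alpha> a + u)) * Re (B $ a $ a)"
        by (metis divide_inverse mult.commute mult.left_neutral)
      ultimately show "\<alpha> a + u + (ln (l a + 1) + Re (B $ a $ a) / (l a + 1)) =
         softplus (\<alpha> a + u) + exp (\<alpha> a + u) / (1 + exp (\<alpha> a + u)) * Re (B $ a $ a)" by simp
    qed
    moreover have "(\<Sum>a\<in>UNIV. ln (l a + 1) + Re (B $ a $ a) / (l a + 1)) \<le> ln (cmod (det (L + mexp B)))"
      by (rule tangent(2)) (simp add: l_def)
    ultimately show ?thesis by linarith
  qed
  then show ?thesis
    unfolding normC by (rule square_tangent_from_softplus) (simp add: sc sb tr\<alpha>)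
qed

section \<open>Representations\<close>

lemma has_vector_derivative_vecI:
  fixes f :: "real \<Rightarrow> 'a::real_normed_vector^'n"
  assumes "\<And>i. ((\<lambda>t. f t $ i) has_vector_derivative D $ i) (at x)"
  shows "(f has_vector_derivative D) (at x)"
  using assms unfolding has_vector_derivative_def has_derivative_def
  by (auto intro!: vec_tendstoI bounded_linear_scaleR_left)

lemma differentiable_prod:
  fixes f :: "'i \<Rightarrow> 'a::real_normed_vector \<Rightarrow> 'b::real_normed_field"
  assumes "\<And>i. i \<in> I \<Longrightarrow> f i differentiable (at x within S)"
  shows "(\<lambda>x. \<Prod>i\<in>I. f i x) differentiable (at x within S)"
  using assms by (induction I rule: infinite_finite_induct) auto

lemma differentiable_matrixI:
  fixes f :: "'a::euclidean_space \<Rightarrow> complex^'m^'m"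
  assumes "\<And>p q. (\<lambda>x. f x $ p $ q) differentiable (at x)"
  shows "f differentiable (at x)"
proof -
  have "(\<lambda>x. f x \<bullet> b) differentiable (at x)" if "b \<in> Basis" for b
  proof -
    from that obtain p q c where "b = axis p (axis q c)"
      by (auto simp: Basis_vec_def)
    then have "(\<lambda>x. f x \<bullet> b) = (\<lambda>x. f x $ p $ q \<bullet> c)"
      by (simp add: inner_axis)
    then show ?thesis
      using differentiable_compose[OF bounded_linear_imp_differentiable[OF bounded_linear_inner_left] assms]
      by simp
  qed
  then show ?thesis using differentiable_componentwise_within[of f x UNIV] by simp
qed

lemma differentiable_entry: "(\<lambda>g :: ('n::finite, 'd::finite) mtuple. g $ i $ a $ b) differentiable F"
  by (intro bounded_linear_imp_differentiable bounded_linear_compose[OF bounded_linear_vec_nth]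
      bounded_linear_vec_nth)

text \<open>\<open>SL\<close> is not open in matrix space and a representation is arbitrary off it.
  The polynomial takes over: it is differentiable everywhere and carries entire curves to entire
  functions.\<close>

lemma polynomial_on_SL_extension:
  fixes f :: "('n::finite, 'd::finite) mtuple \<Rightarrow> complex"
  assumes "polynomial_on_SL f"
  obtains F where "\<And>g. g \<in> SL \<Longrightarrow> f g = F g" "\<And>x. F differentiable (at x)"
    "\<And>\<gamma> :: complex \<Rightarrow> ('n, 'd) mtuple. (\<And>i a b. (\<lambda>z. \<gamma> z $ i $ a $ b) holomorphic_on UNIV) \<Longrightarrow> (\<lambda>z. F (\<gamma> z)) holomorphic_on UNIV"
proof -
  obtain M :: "('d \<Rightarrow> 'n \<Rightarrow> 'n \<Rightarrow> nat) set" and c where "finite M" and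
    f: "\<And>g. g \<in> SL \<Longrightarrow> f g = (\<Sum>e\<in>M. c e * (\<Prod>i\<in>UNIV. \<Prod>a\<in>UNIV. \<Prod>b\<in>UNIV. (g $ i $ a $ b) ^ e i a b))"
    using assms unfolding polynomial_on_SL_def by blast
  show thesis
    by (rule that[of "\<lambda>g. \<Sum>e\<in>M. c e * (\<Prod>i\<in>UNIV. \<Prod>a\<in>UNIV. \<Prod>b\<in>UNIV. (g $ i $ a $ b) ^ e i a b)"])
      (use \<open>finite M\<close> in \<open>auto intro!: f holomorphic_intros differentiable_sum differentiable_mult differentiable_prod
         differentiable_power differentiable_entry\<close>)
qed

text \<open>The exponential of \<open>z X\<close> for complex \<open>z\<close>, built from the
  spectral decomposition of each block. Real \<open>z\<close> gives the positive-definite curve,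
  imaginary \<open>z\<close> a curve in \<open>SU\<close>; joining the two axes permits the unitary
  trick.\<close>

lemma herm0_one_parameter_group:
  fixes X :: "('n::finite, 'd::finite) mtuple"
  assumes "X \<in> herm0"
  obtains e :: "complex \<Rightarrow> ('n, 'd) mtuple" where
    "\<And>s. e (of_real s) = texp (s *\<^sub>R X)" "\<And>z. e z \<in> SL" "\<And>s. e (\<i> * of_real s) \<in> SU"
    "\<And>z w. e (z + w) = tmult (e z) (e w)" "e 0 = tone"
    "\<And>i a b. ((\<lambda>z. e z $ i $ a $ b) has_field_derivative X $ i $ a $ b) (at 0)"
    "\<And>i a b. (\<lambda>z. e z $ i $ a $ b) holomorphic_on UNIV"
proof -
  have "\<exists>U x. hconj U ** U = mat 1 \<and> X $ i = U ** diag_mat (\<lambda>a. complex_of_real (x a)) ** hconj U" for i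
    using assms hermitian_diagonalizable[of "X $ i"] unfolding herm0_def by blast
  then obtain U x where U: "\<And>i. hconj (U i) ** U i = mat 1"
    and X: "\<And>i. X $ i = U i ** diag_mat (\<lambda>a. complex_of_real (x i a)) ** hconj (U i)"
    by metis
  have tr: "(\<Sum>a\<in>UNIV. complex_of_real (x i a)) = 0" for i
  proof -
    have "trace (X $ i) = 0" using assms by (simp add: herm0_def)
    then show ?thesis unfolding X trace_unitary_conj[OF U] trace_diag_mat .
  qed
  define e where "e z = (\<chi> i. U i ** diag_mat (\<lambda>a. exp (z * of_real (x i a))) ** hconj (U i))" for z
  have SL: "e z \<in> SL" for z
    unfolding SL_def
    by (simp add: e_def det_unitary_conj[OF U] det_diag_mat exp_sum[symmetric] sum_distrib_left[symmetric] tr)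
  show thesis
  proof (rule that[of e])
    show "e (of_real s) = texp (s *\<^sub>R X)" for s
    proof -
      have sX: "(s *\<^sub>R X) $ i = U i ** diag_mat (\<lambda>a. of_real s * of_real (x i a)) ** hconj (U i)" for i
        unfolding vec_eq_iff vector_scaleR_component X conj_diag_mat_nth
        by (simp add: scaleR_sum_right scaleR_conv_of_real[where 'a=complex] sum_distrib_left mult_ac)
      show ?thesis
        unfolding e_def texp_def sX mexp_diagonalizable[OF U] ..
    qed
    show "e z \<in> SL" for z by (rule SL)
    show "e (\<i> * of_real s) \<in> SU" for s
    proof -
      have "hconj (e (\<i> * of_real s) $ i) ** e (\<i> * of_real s) $ i = mat 1" for i
        by (simp add: e_def hconj_conj_diag_mat conj_diag_mat_mult[OF U] exp_cnj exp_add[symmetric]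
            conj_diag_mat_1[OF U])
      then show ?thesis using SL by (simp add: SU_def)
    qed
    show "e (z + w) = tmult (e z) (e w)" for z w
      by (simp add: e_def tmult_def vec_eq_iff conj_diag_mat_mult[OF U] distrib_right exp_add)
    show "e 0 = tone"
      by (simp add: e_def tone_def vec_eq_iff conj_diag_mat_1[OF U])
    show "((\<lambda>z. e z $ i $ a $ b) has_field_derivative X $ i $ a $ b) (at 0)" for i a b
      unfolding e_def X vec_lambda_beta conj_diag_mat_nth
      by (rule derivative_eq_intros refl | simp add: mult_ac)+
    show "(\<lambda>z. e z $ i $ a $ b) holomorphic_on UNIV" for i a b
      unfolding e_def vec_lambda_beta conj_diag_mat_nth by (intro holomorphic_intros)
  qed
qed

section \<open>Self-adjointness and the derivative of the representation\<close>

locale unitary_representation =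
  fixes \<pi> :: "('n::finite, 'd::finite) mtuple \<Rightarrow> complex^'m^'m"
    and H :: "complex^'m \<Rightarrow> complex^'m \<Rightarrow> complex"
  assumes rep: "rational_representation \<pi>"
    and inner: "hermitian_inner_product H"
    and invariant: "SU_invariant \<pi> H"
begin

lemma H_add_right: "H x (y + z) = H x y + H x z"
  and H_scale_right: "H x (c *s y) = c * H x y"
  and H_sym: "H y x = cnj (H x y)"
  and H_pos: "x \<noteq> 0 \<Longrightarrow> Re (H x x) > 0"
  using inner unfolding hermitian_inner_product_def by blast+

lemma H_add_left: "H (x + y) z = H x z + H y z"
  by (metis H_add_right H_sym complex_cnj_add)

lemma H_scale_left: "H (c *s x) y = cnj c * H x y"
  by (metis H_scale_right H_sym complex_cnj_mult)

lemma H_zero_right [simp]: "H x 0 = 0"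
  using H_scale_right[of x 0 0] by simp

lemma H_scaleR_right: "H x (r *\<^sub>R y) = of_real r * H x y"
  using H_scale_right[of x "of_real r" y]
  by (simp add: scaleR_vec_def vector_scalar_mult_def scaleR_conv_of_real)

lemma H_self: "H x x = of_real (Re (H x x))"
  by (metis H_sym Reals_cnj_iff of_real_Re)

lemma H_self_nonneg: "Re (H x x) \<ge> 0"
  using H_pos[of x] by (cases "x = 0") auto

lemma H_sum_right: "H x (\<Sum>i\<in>I. f i) = (\<Sum>i\<in>I. H x (f i))"
  by (induction I rule: infinite_finite_induct) (auto simp: H_add_right)

text \<open>\<open>H\<close> is given by algebraic axioms alone; coordinates reduce continuity,
  differentiability and holomorphy of expressions in \<open>H\<close> to those of entries.\<close>

lemma H_expand_right: "H x y = (\<Sum>q\<in>UNIV. y $ q * H x (axis q 1))"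
proof -
  have "H x y = H x (\<Sum>q\<in>UNIV. y $ q *s axis q 1)" by (simp add: basis_expansion)
  then show ?thesis by (simp only: H_sum_right H_scale_right)
qed

lemma H_expand: "H x y = (\<Sum>q\<in>UNIV. \<Sum>p\<in>UNIV. y $ q * (cnj (x $ p) * H (axis p 1) (axis q 1)))"
proof -
  have "H x (axis q 1) = (\<Sum>p\<in>UNIV. cnj (x $ p) * H (axis p 1) (axis q 1))" for q
  proof -
    have "H x (axis q 1) = cnj (H (axis q 1) x)" by (rule H_sym)
    also have "\<dots> = (\<Sum>p\<in>UNIV. cnj (x $ p) * cnj (H (axis q 1) (axis p 1)))"
      by (subst H_expand_right) simp
    finally show ?thesis by (simp only: H_sym[of "axis _ 1" "axis q 1", symmetric])
  qed
  then show ?thesis by (subst H_expand_right) (simp only: sum_distrib_left)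
qed

lemma H_Cauchy_Schwarz: "(cmod (H x y))\<^sup>2 \<le> Re (H x x) * Re (H y y)"
proof (cases "y = 0")
  case False
  define t where "t = Re (H y y)"
  have t: "t > 0" "H y y = of_real t" using H_pos[OF False] H_self[of y] by (auto simp: t_def)
  define h where "h = H x y"
  have hyx: "H y x = cnj h" by (simp add: h_def H_sym[symmetric])
  define c where "c = - cnj h / of_real t"
  have "H (x + c *s y) (x + c *s y) = H x x + c * h + cnj c * cnj h + cnj c * c * of_real t"
    by (simp add: H_add_left H_add_right H_scale_left H_scale_right t(2) hyx h_def[symmetric] algebra_simps)
  also have "\<dots> = H x x - h * cnj h / of_real t"
    using t(1) by (simp add: c_def field_simps)
  also have "\<dots> = H x x - of_real ((cmod h)\<^sup>2 / t)"
    by (simp add: complex_norm_square[symmetric])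
  finally have "Re (H x x) - (cmod h)\<^sup>2 / t \<ge> 0"
    using H_self_nonneg[of "x + c *s y"] by simp
  then show ?thesis using t(1) by (simp add: h_def t_def[symmetric] field_simps)
qed simp

lemma rep_mult: "g \<in> SL \<Longrightarrow> h \<in> SL \<Longrightarrow> \<pi> (tmult g h) = \<pi> g ** \<pi> h"
  and rep_one: "\<pi> tone = mat 1"
  using rep unfolding rational_representation_def by blast+

lemma extension:
  obtains P where "\<And>g. g \<in> SL \<Longrightarrow> \<pi> g = P g" "\<And>x. P differentiable (at x)"
    "\<And>(\<gamma> :: complex \<Rightarrow> ('n, 'd) mtuple) p q. (\<And>i a b. (\<lambda>z. \<gamma> z $ i $ a $ b) holomorphic_on UNIV) \<Longrightarrow>
      (\<lambda>z. P (\<gamma> z) $ p $ q) holomorphic_on UNIV"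
proof -
  define ext where "ext p q F \<longleftrightarrow> (\<forall>g\<in>SL. \<pi> g $ p $ q = F g) \<and> (\<forall>x. F differentiable (at x)) \<and>
    (\<forall>\<gamma> :: complex \<Rightarrow> ('n, 'd) mtuple. (\<forall>i a b. (\<lambda>z. \<gamma> z $ i $ a $ b) holomorphic_on UNIV) \<longrightarrow>
       (\<lambda>z. F (\<gamma> z)) holomorphic_on UNIV)" for p q F
  have "\<exists>F. ext p q F" for p q
  proof -
    have "polynomial_on_SL (\<lambda>g. \<pi> g $ p $ q)"
      using rep unfolding rational_representation_def by blast
    then show ?thesis
      unfolding ext_def by (rule polynomial_on_SL_extension) blast
  qed
  then obtain F where "\<And>p q. ext p q (F p q)" by metis
  then have F: "\<And>p q g. g \<in> SL \<Longrightarrow> \<pi> g $ p $ q = F p q g"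
    "\<And>p q x. F p q differentiable (at x)"
    "\<And>p q (\<gamma> :: complex \<Rightarrow> ('n, 'd) mtuple). (\<And>i a b. (\<lambda>z. \<gamma> z $ i $ a $ b) holomorphic_on UNIV) \<Longrightarrow>
       (\<lambda>z. F p q (\<gamma> z)) holomorphic_on UNIV"
    unfolding ext_def by blast+
  show thesis
    by (rule that[of "\<lambda>g. \<chi> p q. F p q g"])
      (auto simp: vec_eq_iff F intro!: differentiable_matrixI)
qed

text \<open>The function \<open>z \<mapsto> \<langle>\<pi>(e\<^sup>-\<^sup>z\<^sup>*\<^sup>X) x, \<pi>(e\<^sup>z\<^sup>X) y\<rangle>\<close> is entire, and constant on the imaginary axis by
  invariance under \<^const>\<open>SU\<close>; hence it is constant.\<close>

lemma rep_texp_selfadjoint: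
  assumes "X \<in> herm0"
  shows "H (\<pi> (texp X) *v x) y = H x (\<pi> (texp X) *v y)"
proof -
  obtain e :: "complex \<Rightarrow> ('n, 'd) mtuple" where e: "\<And>s. e (of_real s) = texp (s *\<^sub>R X)"
    "\<And>z. e z \<in> SL" "\<And>s. e (\<i> * of_real s) \<in> SU" "\<And>z w. e (z + w) = tmult (e z) (e w)" "e 0 = tone"
    "\<And>i a b. (\<lambda>z. e z $ i $ a $ b) holomorphic_on UNIV"
    by (rule herm0_one_parameter_group[OF assms]) blast
  obtain P where P: "\<And>g. g \<in> SL \<Longrightarrow> \<pi> g = P g"
    "\<And>(\<gamma> :: complex \<Rightarrow> ('n, 'd) mtuple) p q. (\<And>i a b. (\<lambda>z. \<gamma> z $ i $ a $ b) holomorphic_on UNIV) \<Longrightarrow>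
      (\<lambda>z. P (\<gamma> z) $ p $ q) holomorphic_on UNIV"
    by (rule extension) blast
  define R where "R z = \<pi> (e z)" for z
  have R: "(\<lambda>z. R z $ p $ q) holomorphic_on UNIV" for p q
    using P(2)[OF e(6)] P(1)[OF e(2)] by (simp add: R_def)
  \<comment> \<open>Conjugating both argument and value preserves holomorphy. This serves the first
    slot of \<open>H\<close>, where \<open>H\<close> is conjugate-linear.\<close>
  have Rc: "(\<lambda>z. cnj (R (- cnj z) $ p $ q)) holomorphic_on UNIV" for p q
  proof -
    have "cnj \<circ> (\<lambda>z. R (- z) $ p $ q) \<circ> cnj holomorphic_on UNIV"
    proof (rule holomorphic_on_compose_cnj_cnj)
      have "(\<lambda>z. R z $ p $ q) \<circ> uminus holomorphic_on UNIV"
        by (intro holomorphic_on_compose holomorphic_intros holomorphic_on_subset[OF R]) auto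
      then show "(\<lambda>z. R (- z) $ p $ q) holomorphic_on cnj ` UNIV"
        unfolding o_def by (rule holomorphic_on_subset) auto
    qed auto
    then show ?thesis by (simp add: o_def)
  qed
  define F where "F x y z = H (R (- cnj z) *v x) (R z *v y)" for x y z
  have F: "F x y holomorphic_on UNIV" for x y
  proof -
    have "F x y = (\<lambda>z. \<Sum>q\<in>UNIV. \<Sum>p\<in>UNIV. (\<Sum>j\<in>UNIV. R z $ q $ j * y $ j) *
       ((\<Sum>j\<in>UNIV. cnj (R (- cnj z) $ p $ j) * cnj (x $ j)) * H (axis p 1) (axis q 1)))"
      unfolding F_def by (rule ext, subst H_expand) (simp add: matrix_vector_mult_def)
    then show ?thesis by (simp only:) (intro holomorphic_intros R Rc)
  qed
  \<comment> \<open>On the imaginary axis \<open>- cnj z = z\<close>, so both slots carry the same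
    element of \<open>SU\<close>.\<close>
  have FI: "F x y (\<i> * of_real s) = H x y" for x y s
    using invariant e(3)[of s] unfolding SU_invariant_def F_def R_def by simp
  have const: "F x y z = H x y" for x y z
  proof -
    have "F x y z - H x y = 0"
    proof (rule analytic_continuation[of "\<lambda>z. F x y z - H x y" UNIV "range (\<lambda>s::real. \<i> * of_real s)" 0 z])
      show "(\<lambda>z. F x y z - H x y) holomorphic_on UNIV" by (intro holomorphic_intros F)
      show "0 islimpt range (\<lambda>s::real. \<i> * complex_of_real s)"
        unfolding islimpt_approachable
      proof (intro allI impI)
        fix \<epsilon> :: real assume "\<epsilon> > 0"
        then have "\<i> * complex_of_real (\<epsilon> / 2) \<noteq> 0" "dist (\<i> * complex_of_real (\<epsilon> / 2)) 0 < \<epsilon>"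
          by (simp_all add: norm_mult norm_divide)
        then show "\<exists>x'\<in>range (\<lambda>s::real. \<i> * complex_of_real s). x' \<noteq> 0 \<and> dist x' 0 < \<epsilon>" by blast
      qed
    qed (use FI in auto)
    then show ?thesis by simp
  qed
  have e1: "e 1 = texp X" using e(1)[of 1] by simp
  have "R (- 1) ** R 1 = mat 1"
    using rep_mult[OF e(2)[of "-1"] e(2)[of 1]] e(4)[of "-1" 1] e(5) rep_one by (simp add: R_def)
  then have inv: "R (- 1) *v (R 1 *v x) = x"
    by (simp add: matrix_vector_mul_assoc)
  \<comment> \<open>At \<open>z = 1\<close>, with \<open>R 1 *v x\<close> in place of
    \<open>x\<close>, the factor \<open>R (- 1)\<close> undoes \<open>R 1\<close>.\<close>
  show ?thesis
    using const[of "R 1 *v x" y 1] inv by (simp add: F_def R_def e1)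
qed

text \<open>The curve \<open>texp (t *\<^sub>R X)\<close> has velocity \<open>X\<close> at the
  identity, so by the chain rule \<open>L\<close> is the derivative there of the polynomial
  extension of \<open>\<pi>\<close>, and a derivative is linear.\<close>

lemma lie_rep_linear:
  obtains L where "linear L"
    "\<And>X. X \<in> herm0 \<Longrightarrow> lie_rep \<pi> X = L X"
    "\<And>X. X \<in> herm0 \<Longrightarrow> ((\<lambda>t. \<pi> (texp (t *\<^sub>R X))) has_vector_derivative L X) (at 0)"
proof -
  obtain P where P: "\<And>g. g \<in> SL \<Longrightarrow> \<pi> g = P g" "\<And>x. P differentiable (at x)"
    by (rule extension) blast
  obtain L where L: "(P has_derivative L) (at tone)"
    using P(2)[of tone] unfolding differentiable_def by blast
  have der: "((\<lambda>t. \<pi> (texp (t *\<^sub>R X))) has_vector_derivative L X) (at 0)" if X: "X \<in> herm0" for X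
  proof -
    obtain e :: "complex \<Rightarrow> ('n, 'd) mtuple" where e: "\<And>s. e (of_real s) = texp (s *\<^sub>R X)"
      "\<And>z. e z \<in> SL" "e 0 = tone"
      "\<And>i a b. ((\<lambda>z. e z $ i $ a $ b) has_field_derivative X $ i $ a $ b) (at 0)"
      by (rule herm0_one_parameter_group[OF X]) blast
    have "((\<lambda>t. e (of_real t)) has_vector_derivative X) (at 0)"
      by (intro has_vector_derivative_vecI has_vector_derivative_real_field) (simp add: e(4))
    moreover have "(P has_derivative L) (at (e (of_real 0)) within range (\<lambda>t. e (of_real t)))"
      using L by (simp add: e(3) has_derivative_at_withinI)
    ultimately have "(P \<circ> (\<lambda>t. e (of_real t)) has_vector_derivative L X) (at 0)"
      using vector_derivative_diff_chain_within[of "\<lambda>t. e (of_real t)" X 0 UNIV P L] by simp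
    moreover have "\<pi> (texp (t *\<^sub>R X)) = P (texp (t *\<^sub>R X))" for t
      using P(1)[OF e(2)[of "of_real t"]] by (simp add: e(1))
    ultimately show ?thesis by (simp add: o_def e(1))
  qed
  have "lie_rep \<pi> X = L X" if "X \<in> herm0" for X
    unfolding lie_rep_def by (rule vector_derivative_at[OF der[OF that]])
  then show thesis
    using that[OF has_derivative_linear[OF L]] der by blast
qed

end

section \<open>Moment maps\<close>

lemma rdiag0_subset_herm0: "rdiag0 \<subseteq> herm0"
proof
  fix A :: "('a, 'b) mtuple" assume A: "A \<in> rdiag0"
  have "hconj (A $ i) $ a $ b = A $ i $ a $ b" for i a b
    using A by (cases "a = b") (auto simp: rdiag0_def diagonal_def Reals_cnj_iff)
  then show "A \<in> herm0" using A by (simp add: herm0_def rdiag0_def vec_eq_iff)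
qed

lemma subspace_herm0: "subspace (herm0 :: ('n::finite, 'd::finite) mtuple set)"
  unfolding subspace_def herm0_def
  by (auto simp: vec_eq_iff trace_def sum.distrib scaleR_sum_right[symmetric])

lemma subspace_rdiag0: "subspace (rdiag0 :: ('n::finite, 'd::finite) mtuple set)"
  unfolding subspace_def rdiag0_def diagonal_def
  by (auto simp: trace_def sum.distrib scaleR_conv_of_real[where 'a = complex] sum_distrib_left[symmetric])

text \<open>Hermitian symmetry turns the trace form into the real Frobenius inner product. A moment
  map thereby becomes the vector representing a linear functional on a Euclidean subspace.\<close>

lemma ttrace_tmult_herm0:
  fixes M A :: "('n::finite, 'd::finite) mtuple"
  assumes "M \<in> herm0" "A \<in> herm0"
  shows "ttrace (tmult M A) = of_real (M \<bullet> A)"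
proof -
  have h: "M $ i $ a $ b = cnj (M $ i $ b $ a)" "A $ i $ a $ b = cnj (A $ i $ b $ a)" for i a b
    using assms unfolding herm0_def by (metis (mono_tags, lifting) hconj_nth mem_Collect_eq)+
  have t: "ttrace (tmult M A) = (\<Sum>i\<in>UNIV. \<Sum>a\<in>UNIV. \<Sum>b\<in>UNIV. M $ i $ a $ b * A $ i $ b $ a)"
    by (simp add: ttrace_def tmult_def trace_def matrix_matrix_mult_def)
  also have "\<dots> = (\<Sum>i\<in>UNIV. \<Sum>a\<in>UNIV. \<Sum>b\<in>UNIV. M $ i $ a $ b * cnj (A $ i $ a $ b))"
    by (intro sum.cong refl) (metis h(2))
  finally have t: "ttrace (tmult M A) = (\<Sum>i\<in>UNIV. \<Sum>a\<in>UNIV. \<Sum>b\<in>UNIV. M $ i $ a $ b * cnj (A $ i $ a $ b))" .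
  have "cnj (ttrace (tmult M A)) = (\<Sum>i\<in>UNIV. \<Sum>a\<in>UNIV. \<Sum>b\<in>UNIV. cnj (M $ i $ a $ b) * A $ i $ a $ b)"
    unfolding t by simp
  also have "\<dots> = (\<Sum>i\<in>UNIV. \<Sum>a\<in>UNIV. \<Sum>b\<in>UNIV. M $ i $ b $ a * cnj (A $ i $ b $ a))"
    by (intro sum.cong refl) (metis h)
  also have "\<dots> = ttrace (tmult M A)"
    unfolding t by (rule sum.cong[OF refl]) (rule sum.swap)
  finally have "ttrace (tmult M A) \<in> \<real>" by (simp add: Reals_cnj_iff)
  moreover have "Re (ttrace (tmult M A)) = M \<bullet> A"
    unfolding t by (simp add: inner_vec_def inner_complex_def)
  ultimately show ?thesis by (metis of_real_Re)
qed

lemma inner_rdiag0: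
  fixes A X :: "('n::finite, 'd::finite) mtuple"
  assumes "A \<in> rdiag0"
  shows "A \<bullet> X = (\<Sum>i\<in>UNIV. \<Sum>a\<in>UNIV. Re (A $ i $ a $ a) * Re (X $ i $ a $ a))"
proof -
  have "A \<bullet> X = (\<Sum>i\<in>UNIV. \<Sum>a\<in>UNIV. \<Sum>b\<in>UNIV. A $ i $ a $ b \<bullet> X $ i $ a $ b)"
    by (simp add: inner_vec_def)
  also have "\<dots> = (\<Sum>i\<in>UNIV. \<Sum>a\<in>UNIV. A $ i $ a $ a \<bullet> X $ i $ a $ a)"
    using assms by (intro sum.cong refl sum_one_supported) (auto simp: rdiag0_def diagonal_def)
  also have "\<dots> = (\<Sum>i\<in>UNIV. \<Sum>a\<in>UNIV. Re (A $ i $ a $ a) * Re (X $ i $ a $ a))"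
    using assms by (intro sum.cong refl) (auto simp: rdiag0_def inner_complex_def complex_is_Real_iff)
  finally show ?thesis .
qed

text \<open>On \<open>herm0\<close> this is the orthogonal projection onto \<open>rdiag0\<close>, as
  \<open>inner_tdiag\<close> expresses.\<close>

definition tdiag :: "('n::finite, 'd::finite) mtuple \<Rightarrow> ('n, 'd) mtuple" where
  "tdiag X = (\<chi> i. diag_mat (\<lambda>a. X $ i $ a $ a))"

lemma tdiag_in_rdiag0: "X \<in> herm0 \<Longrightarrow> tdiag X \<in> rdiag0"
proof -
  assume X: "X \<in> herm0"
  have "X $ i $ a $ a \<in> \<real>" for i a
    using X unfolding herm0_def Reals_cnj_iff by (metis (mono_tags, lifting) hconj_nth mem_Collect_eq)
  then show ?thesis
    using X by (simp add: tdiag_def rdiag0_def diagonal_def trace_diag_mat herm0_def trace_def)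
qed

lemma inner_tdiag: "A \<in> rdiag0 \<Longrightarrow> A \<bullet> tdiag X = A \<bullet> X"
  by (simp add: inner_rdiag0 tdiag_def)

lemma texp_rdiag0:
  assumes "A \<in> rdiag0"
  shows "texp A = (\<chi> i. diag_mat (\<lambda>a. exp (A $ i $ a $ a)))"
proof -
  have A: "A $ i = diag_mat (\<lambda>a. A $ i $ a $ a)" for i
    using assms by (intro diagonal_eq_diag_mat) (simp add: rdiag0_def)
  have "mexp (A $ i) = diag_mat (\<lambda>a. exp (A $ i $ a $ a))" for i
    by (rule trans[OF arg_cong[OF A, of mexp] mexp_diag_mat])
  then show ?thesis by (simp add: texp_def)
qed

lemma texp_in_SL:
  fixes X :: "('n::finite, 'd::finite) mtuple"
  assumes "X \<in> herm0"
  shows "texp X \<in> SL"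
proof -
  obtain e :: "complex \<Rightarrow> ('n, 'd) mtuple" where "\<And>s. e (of_real s) = texp (s *\<^sub>R X)" "\<And>z. e z \<in> SL"
    by (rule herm0_one_parameter_group[OF assms]) blast
  from this(1)[of 1] this(2)[of 1] show ?thesis by simp
qed

lemma texp_rdiag0_in_ST: "A \<in> rdiag0 \<Longrightarrow> texp A \<in> ST"
  using texp_in_SL[of A] rdiag0_subset_herm0
  by (auto simp: ST_def texp_rdiag0 diagonal_def)

lemma texp_rdiag0_mult:
  assumes "A \<in> rdiag0" "D \<in> rdiag0"
  shows "tmult (texp A) (texp D) = texp (A + D)"
  using assms subspace_add[OF subspace_rdiag0 assms]
  by (simp add: texp_rdiag0 tmult_def diag_mat_mult exp_add)

text \<open>Riesz representation: represent \<open>l\<close> on the whole space, then project onto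
  \<open>S\<close>. The difference of two solutions lies in \<open>S\<close> and is orthogonal to
  itself. Unique existence is what gives the \<open>THE\<close> in \<open>moment_map\<close> its
  meaning.\<close>

lemma moment_map_exists:
  fixes S :: "('n::finite, 'd::finite) mtuple set" and l :: "('n, 'd) mtuple \<Rightarrow> real"
  assumes S: "subspace S" "S \<subseteq> herm0" and l: "linear l"
    and H: "\<And>A. A \<in> S \<Longrightarrow> H v (lie_rep \<pi> A *v v) / H v v = of_real (l A)"
  shows "moment_map S \<pi> H v \<in> S \<and>
    (\<forall>A\<in>S. ttrace (tmult (moment_map S \<pi> H v) A) = H v (lie_rep \<pi> A *v v) / H v v)"
  unfolding moment_map_def
proof (rule theI')
  define M0 where "M0 = (\<Sum>b\<in>Basis. l b *\<^sub>R b)"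
  have M0: "M0 \<bullet> A = l A" for A
  proof -
    have "l A = l (\<Sum>b\<in>Basis. (A \<bullet> b) *\<^sub>R b)" by (simp add: euclidean_representation)
    also have "\<dots> = (\<Sum>b\<in>Basis. (A \<bullet> b) *\<^sub>R l b)"
      using l by (simp add: linear_sum linear_scale)
    finally show ?thesis by (simp add: M0_def inner_sum_left) (simp add: inner_commute mult.commute)
  qed
  obtain M N where M: "M \<in> S" and N: "\<And>w. w \<in> S \<Longrightarrow> orthogonal N w" and MN: "M0 = M + N"
    using orthogonal_subspace_decomp_exists[of S M0] S(1) by (metis span_eq_iff)
  have MA: "M \<bullet> A = l A" if "A \<in> S" for A
    using N[OF that] M0[of A] MN by (simp add: orthogonal_def inner_add_left)
  have iff: "(\<forall>A\<in>S. ttrace (tmult M' A) = H v (lie_rep \<pi> A *v v) / H v v) \<longleftrightarrow> (\<forall>A\<in>S. M' \<bullet> A = l A)"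
    if "M' \<in> S" for M'
  proof (rule ball_cong[OF refl])
    fix A assume A: "A \<in> S"
    have "ttrace (tmult M' A) = of_real (M' \<bullet> A)"
      by (rule ttrace_tmult_herm0) (use that A S(2) in auto)
    then show "(ttrace (tmult M' A) = H v (lie_rep \<pi> A *v v) / H v v) = (M' \<bullet> A = l A)"
      unfolding H[OF A] by (simp only: of_real_eq_iff)
  qed
  show "\<exists>!M. M \<in> S \<and> (\<forall>A\<in>S. ttrace (tmult M A) = H v (lie_rep \<pi> A *v v) / H v v)"
  proof (rule ex1I[of _ M])
    show "M \<in> S \<and> (\<forall>A\<in>S. ttrace (tmult M A) = H v (lie_rep \<pi> A *v v) / H v v)"
      using M MA iff[OF M] by blast
    fix M' assume "M' \<in> S \<and> (\<forall>A\<in>S. ttrace (tmult M' A) = H v (lie_rep \<pi> A *v v) / H v v)"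
    then have M': "M' \<in> S" "\<And>A. A \<in> S \<Longrightarrow> M' \<bullet> A = l A" using iff[of M'] by blast+
    have "M' - M \<in> S" using M M'(1) S(1) by (simp add: subspace_diff)
    then have "(M' - M) \<bullet> (M' - M) = 0"
      using M'(2)[of "M' - M"] MA[of "M' - M"] by (simp add: inner_diff_left)
    then show "M' = M" by simp
  qed
qed

context unitary_representation
begin

text \<open>The expectation at \<open>w\<close> is linear in the matrix, so differentiation passes
  through it. The slope is real because self-adjointness of
  \<open>\<pi> (texp (t *\<^sub>R X))\<close> keeps the whole curve real.\<close>

lemma has_real_derivative_expectation:
  assumes X: "X \<in> herm0"
  shows "((\<lambda>t. Re (H w (\<pi> (texp (t *\<^sub>R X)) *v w))) has_real_derivative Re (H w (lie_rep \<pi> X *v w))) (at 0)"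
    and "H w (lie_rep \<pi> X *v w) \<in> \<real>"
proof -
  obtain L where L: "lie_rep \<pi> X = L X"
    "((\<lambda>t. \<pi> (texp (t *\<^sub>R X))) has_vector_derivative L X) (at 0)"
    by (rule lie_rep_linear) (use X in blast)
  have bl: "bounded_linear (\<lambda>M :: complex^'m^'m. H w (M *v w))"
  proof -
    have "(\<lambda>M :: complex^'m^'m. H w (M *v w)) = (\<lambda>M. \<Sum>q\<in>UNIV. (\<Sum>j\<in>UNIV. M $ q $ j * w $ j) * H w (axis q 1))"
      by (rule ext, subst H_expand_right) (simp add: matrix_vector_mult_def)
    moreover have "bounded_linear (\<lambda>M :: complex^'m^'m. \<Sum>q\<in>UNIV. (\<Sum>j\<in>UNIV. M $ q $ j * w $ j) * H w (axis q 1))"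
      by (intro bounded_linear_sum bounded_linear_mult_const
          bounded_linear_compose[OF bounded_linear_vec_nth bounded_linear_vec_nth])
    ultimately show ?thesis by simp
  qed
  have d: "((\<lambda>t. H w (\<pi> (texp (t *\<^sub>R X)) *v w)) has_vector_derivative H w (lie_rep \<pi> X *v w)) (at 0)"
    using bounded_linear.has_vector_derivative[OF bl L(2)] L(1) by simp
  from bounded_linear.has_vector_derivative[OF bounded_linear_Re d]
  show "((\<lambda>t. Re (H w (\<pi> (texp (t *\<^sub>R X)) *v w))) has_real_derivative Re (H w (lie_rep \<pi> X *v w))) (at 0)"
    by (simp add: has_real_derivative_iff_has_vector_derivative)
  have "Im (H w (\<pi> (texp (t *\<^sub>R X)) *v w)) = 0" for t
  proof -
    have "t *\<^sub>R X \<in> herm0" by (rule subspace_scale[OF subspace_herm0 X])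
    then have "H w (\<pi> (texp (t *\<^sub>R X)) *v w) = cnj (H w (\<pi> (texp (t *\<^sub>R X)) *v w))"
      using rep_texp_selfadjoint[of "t *\<^sub>R X" w w] H_sym by metis
    then show ?thesis by (metis Reals_cnj_iff complex_is_Real_iff)
  qed
  then have "((\<lambda>t::real. 0::real) has_vector_derivative Im (H w (lie_rep \<pi> X *v w))) (at 0)"
    using bounded_linear.has_vector_derivative[OF bounded_linear_Im d] by simp
  then have "Im (H w (lie_rep \<pi> X *v w)) = 0"
    using has_vector_derivative_const vector_derivative_unique_at by blast
  then show "H w (lie_rep \<pi> X *v w) \<in> \<real>" by (simp add: complex_is_Real_iff)
qed

text \<open>With \<open>x\<close> reached from \<open>w\<close> in half the time, the value at
  \<open>s\<close> is the squared norm of \<open>x\<close> and the value at \<open>s / 2\<close> is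
  the real part of \<open>H w x\<close>. Cauchy-Schwarz and the arithmetic-geometric mean inequality
  give midpoint convexity.\<close>

lemma expectation_tangent:
  assumes X: "X \<in> herm0"
  shows "Re (H w w) + Re (H w (lie_rep \<pi> X *v w)) \<le> Re (H w (\<pi> (texp X) *v w))"
proof -
  obtain e :: "complex \<Rightarrow> ('n, 'd) mtuple" where e: "\<And>s. e (of_real s) = texp (s *\<^sub>R X)"
    "\<And>z. e z \<in> SL" "\<And>z w. e (z + w) = tmult (e z) (e w)" "e 0 = tone"
    by (rule herm0_one_parameter_group[OF X]) blast
  define \<phi> where "\<phi> s = Re (H w (\<pi> (texp (s *\<^sub>R X)) *v w))" for s
  have \<phi>0: "\<phi> 0 = Re (H w w)"
    using e(1)[of 0] e(4) rep_one by (simp add: \<phi>_def)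
  have sX: "s *\<^sub>R X \<in> herm0" for s by (rule subspace_scale[OF subspace_herm0 X])
  have mid: "2 * \<phi> (s / 2) \<le> \<phi> 0 + \<phi> s" for s
  proof -
    define x where "x = \<pi> (texp ((s / 2) *\<^sub>R X)) *v w"
    have "\<pi> (texp (s *\<^sub>R X)) = \<pi> (texp ((s / 2) *\<^sub>R X)) ** \<pi> (texp ((s / 2) *\<^sub>R X))"
      using e(3)[of "of_real (s / 2)" "of_real (s / 2)"] rep_mult[OF e(2) e(2)]
      by (metis e(1) field_sum_of_halves of_real_add)
    then have \<phi>s: "\<phi> s = Re (H x x)"
      unfolding \<phi>_def x_def using rep_texp_selfadjoint[OF sX[of "s / 2"]]
      by (simp add: matrix_vector_mul_assoc[symmetric])
    have "(\<phi> (s / 2))\<^sup>2 \<le> (cmod (H w x))\<^sup>2"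
      unfolding \<phi>_def x_def[symmetric] by (metis abs_Re_le_cmod abs_ge_zero power2_abs power_mono)
    moreover note H_Cauchy_Schwarz[of w x]
    ultimately have "(\<phi> (s / 2))\<^sup>2 \<le> \<phi> 0 * \<phi> s" using \<phi>0 \<phi>s by simp
    moreover have "0 \<le> \<phi> 0" "0 \<le> \<phi> s" using \<phi>0 \<phi>s H_self_nonneg by auto
    moreover have "4 * (\<phi> 0 * \<phi> s) \<le> (\<phi> 0 + \<phi> s)\<^sup>2"
      using sum_squares_bound[of "\<phi> 0" "\<phi> s"] by (simp add: power2_eq_square algebra_simps)
    ultimately have "(2 * \<phi> (s / 2))\<^sup>2 \<le> (\<phi> 0 + \<phi> s)\<^sup>2" "0 \<le> \<phi> 0 + \<phi> s"
      by (auto simp: power_mult_distrib)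
    then show ?thesis by (rule power2_le_imp_le)
  qed
  have "(\<phi> has_real_derivative Re (H w (lie_rep \<pi> X *v w))) (at 0)"
    unfolding \<phi>_def by (rule has_real_derivative_expectation(1)[OF X])
  from midpoint_convex_tangent[of \<phi>, OF mid this] show ?thesis
    by (simp add: \<phi>0) (simp add: \<phi>_def)
qed

lemma lie_rep_expectation_linear:
  obtains l where "linear l" "\<And>A. A \<in> herm0 \<Longrightarrow> Re (H w (lie_rep \<pi> A *v w)) = l A"
proof -
  obtain L where L: "linear L" "\<And>X. X \<in> herm0 \<Longrightarrow> lie_rep \<pi> X = L X"
    by (rule lie_rep_linear) blast
  have scale: "(r *\<^sub>R M) *v w = r *\<^sub>R (M *v w)" for r and M :: "complex^'m^'m"
    by (simp add: vec_eq_iff matrix_vector_mult_def scaleR_sum_right)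
  have "linear (\<lambda>A. Re (H w (L A *v w)))"
    using L(1) by (intro linearI)
      (simp_all add: linear_add linear_scale matrix_vector_mult_add_rdistrib H_add_right scale H_scaleR_right)
  then show thesis using that L(2) by simp
qed

text \<open>After division by \<open>H w w\<close>, both sides are pairings with the common moment
  map, which lies in \<open>rdiag0\<close> and so sees only the diagonal part of
  \<open>X\<close>.\<close>

lemma lie_rep_expectation_tdiag:
  assumes w: "w \<noteq> 0" and eq: "moment_T \<pi> H w = moment_G \<pi> H w" and X: "X \<in> herm0"
  shows "H w (lie_rep \<pi> X *v w) = H w (lie_rep \<pi> (tdiag X) *v w)"
proof -
  obtain l0 where l0: "linear l0" "\<And>A. A \<in> herm0 \<Longrightarrow> Re (H w (lie_rep \<pi> A *v w)) = l0 A"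
    by (rule lie_rep_expectation_linear) blast
  define l where "l A = l0 A / Re (H w w)" for A
  have "linear l"
    unfolding l_def using l0(1) by (intro linearI) (simp_all add: linear_add linear_scale add_divide_distrib)
  have pos: "Re (H w w) > 0" by (rule H_pos[OF w])
  have val: "H w (lie_rep \<pi> A *v w) / H w w = of_real (l A)" if "A \<in> herm0" for A
    using has_real_derivative_expectation(2)[OF that, of w] H_self[of w]
    by (metis l0(2) l_def of_real_Re of_real_divide that)
  note G = moment_map_exists[where H = H and v = w and \<pi> = \<pi>, OF subspace_herm0 order_refl \<open>linear l\<close> val, folded moment_G_def]
  note T = moment_map_exists[where H = H and v = w and \<pi> = \<pi>, OF subspace_rdiag0 rdiag0_subset_herm0 \<open>linear l\<close> val[OF subsetD[OF rdiag0_subset_herm0]],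
      folded moment_T_def]
  define M where "M = moment_T \<pi> H w"
  have M: "M \<in> rdiag0" using T by (simp add: M_def)
  then have MH: "M \<in> herm0" using rdiag0_subset_herm0 by blast
  have MG: "ttrace (tmult M A) = H w (lie_rep \<pi> A *v w) / H w w" if "A \<in> herm0" for A
    using G that by (simp add: M_def eq)
  have D: "tdiag X \<in> herm0" using tdiag_in_rdiag0[OF X] rdiag0_subset_herm0 by blast
  have "ttrace (tmult M X) = ttrace (tmult M (tdiag X))"
    by (simp add: ttrace_tmult_herm0[OF MH X] ttrace_tmult_herm0[OF MH D] inner_tdiag[OF M])
  then have "H w (lie_rep \<pi> X *v w) / H w w = H w (lie_rep \<pi> (tdiag X) *v w) / H w w"
    using MG X D by simp
  then show ?thesis using pos by auto
qed

end

section \<open>The minimum on a geodesic ball\<close>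

text \<open>\<open>B\<close> is the logarithm of \<open>G' ** mexp C ** G'\<close>, with
  \<open>G'\<close> inverse to the diagonal factor. Writing \<open>mexp C\<close> as
  \<open>E ** E\<close> with Hermitian \<open>E\<close> shows that the eigenvalues are nonnegative;
  determinant 1 makes them positive and \<open>B\<close> traceless.\<close>

lemma hermitian_geodesic_exists:
  fixes C :: "complex^'n^'n" and \<alpha> :: "'n \<Rightarrow> real"
  assumes C: "hconj C = C" and trC: "trace C = 0" and tr\<alpha>: "(\<Sum>a\<in>UNIV. \<alpha> a) = 0"
  obtains B where "hconj B = B" "trace B = 0"
    "mexp C = diag_mat (\<lambda>a. of_real (exp (\<alpha> a / 2))) ** mexp B ** diag_mat (\<lambda>a. of_real (exp (\<alpha> a / 2)))"
proof -
  obtain W and c :: "'n \<Rightarrow> real" where W: "hconj W ** W = mat 1"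
    and Cd: "C = W ** diag_mat (\<lambda>a. of_real (c a)) ** hconj W"
    using hermitian_diagonalizable[OF C] by metis
  have sc: "(\<Sum>a\<in>UNIV. complex_of_real (c a)) = 0"
    using trC unfolding Cd trace_unitary_conj[OF W] trace_diag_mat .
  define E where "E = W ** diag_mat (\<lambda>a. exp (of_real (c a) / 2)) ** hconj W"
  have EE: "E ** E = mexp C"
    unfolding E_def Cd mexp_diagonalizable[OF W] by (simp add: conj_diag_mat_mult[OF W] exp_add[symmetric])
  have hE: "hconj E = E" by (simp add: E_def hconj_conj_diag_mat exp_cnj)
  have dE: "det E = 1"
    by (simp add: E_def det_unitary_conj[OF W] det_diag_mat exp_sum[symmetric] sum_divide_distrib[symmetric] sc)
  define G where "G = diag_mat (\<lambda>a. complex_of_real (exp (\<alpha> a / 2)))"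
  define G' where "G' = diag_mat (\<lambda>a. complex_of_real (exp (- \<alpha> a / 2)))"
  have GG': "G ** G' = mat 1" "G' ** G = mat 1"
    by (simp_all add: G_def G'_def diag_mat_mult of_real_mult[symmetric] exp_add[symmetric] diag_mat_1 del: of_real_mult)
  have hG': "hconj G' = G'" by (simp add: G'_def hconj_diag_mat)
  have dG': "det G' = 1"
  proof -
    have "det G' = of_real (exp (\<Sum>a\<in>UNIV. - \<alpha> a / 2))"
      by (simp add: G'_def det_diag_mat exp_sum)
    also have "(\<Sum>a\<in>UNIV. - \<alpha> a / 2) = 0"
      using tr\<alpha> by (simp add: sum_negf sum_divide_distrib[symmetric])
    finally show ?thesis by simp
  qed
  obtain U and d :: "'n \<Rightarrow> real" where U: "hconj U ** U = mat 1"
    and V: "(G' ** E) ** hconj (G' ** E) = U ** diag_mat (\<lambda>a. of_real (d a)) ** hconj U"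
    and d0: "\<And>a. d a \<ge> 0"
    by (rule mult_hconj_diagonalizable[of "G' ** E"]) blast
  have "complex_of_real (\<Prod>a\<in>UNIV. d a) = det ((G' ** E) ** hconj (G' ** E))"
    unfolding V det_unitary_conj[OF U] by (simp add: det_diag_mat)
  also have "\<dots> = 1" by (simp add: det_mul det_hconj dE dG')
  finally have prod: "(\<Prod>a\<in>UNIV. d a) = 1" using of_real_eq_1_iff by blast
  have d: "d a > 0" for a
  proof -
    have "d a \<noteq> 0" using prod by (metis UNIV_I finite prod_zero zero_neq_one)
    then show ?thesis using d0[of a] by simp
  qed
  define B where "B = U ** diag_mat (\<lambda>a. of_real (ln (d a))) ** hconj U"
  have "hconj B = B" by (simp add: B_def hconj_conj_diag_mat)
  moreover have "trace B = 0"
  proof -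
    have "(\<Sum>a\<in>UNIV. ln (d a)) = ln (\<Prod>a\<in>UNIV. d a)"
      using d by (subst ln_prod) (auto simp: less_imp_neq[symmetric])
    then have "(\<Sum>a\<in>UNIV. ln (d a)) = 0" using prod by simp
    then show ?thesis
      unfolding B_def trace_unitary_conj[OF U] trace_diag_mat
      by (simp only: of_real_sum[symmetric] of_real_0)
  qed
  moreover have "mexp C = G ** mexp B ** G"
  proof -
    have "mexp B = (G' ** E) ** hconj (G' ** E)"
      unfolding B_def mexp_diagonalizable[OF U] exp_of_real V using d by simp
    also have "\<dots> = G' ** mexp C ** G'"
      by (simp add: hconj_mult hE hG' EE[symmetric] matrix_mul_assoc)
    finally have "G ** mexp B ** G = (G ** G') ** mexp C ** (G' ** G)"
      by (simp only: matrix_mul_assoc)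
    then show ?thesis by (simp add: GG')
  qed
  ultimately show thesis using that by (simp add: G_def)
qed

lemma norm_mtuple_power2: "(norm (C :: ('n::finite, 'd::finite) mtuple))\<^sup>2 = (\<Sum>i\<in>UNIV. (norm (C $ i))\<^sup>2)"
  by (simp add: norm_vec_def L2_set_def sum_nonneg)

text \<open>The blocks decouple: geodesic and comparison inequality are obtained in each block, with
  \<alpha> the real diagonal of \<open>A\<close>, and the inequalities are summed.\<close>

lemma herm0_geodesic_exists:
  fixes A C :: "('n::finite, 'd::finite) mtuple"
  assumes A: "A \<in> rdiag0" and C: "C \<in> herm0"
  obtains B where "B \<in> herm0"
    "texp C = tmult (texp ((1/2) *\<^sub>R A)) (tmult (texp B) (texp ((1/2) *\<^sub>R A)))"
    "(norm A)\<^sup>2 + 2 * (A \<bullet> B) \<le> (norm C)\<^sup>2"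
proof -
  define \<alpha> where "\<alpha> i a = Re (A $ i $ a $ a)" for i a
  have A\<alpha>: "A $ i $ a $ a = of_real (\<alpha> i a)" for i a
    using A by (simp add: rdiag0_def \<alpha>_def)
  have s\<alpha>: "(\<Sum>a\<in>UNIV. \<alpha> i a) = 0" for i
  proof -
    have "(\<Sum>a\<in>UNIV. \<alpha> i a) = Re (trace (A $ i))" by (simp add: trace_def \<alpha>_def)
    then show ?thesis using A by (simp add: rdiag0_def)
  qed
  have C': "hconj (C $ i) = C $ i" "trace (C $ i) = 0" for i
    using C by (simp_all add: herm0_def)
  let ?G = "\<lambda>i. diag_mat (\<lambda>a. complex_of_real (exp (\<alpha> i a / 2)))"
  have "\<exists>B. hconj B = B \<and> trace B = 0 \<and> mexp (C $ i) = ?G i ** mexp B ** ?G i" for i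
    by (rule hermitian_geodesic_exists[OF C' s\<alpha>[of i]]) blast
  then obtain B where B: "\<And>i. hconj (B i) = B i" "\<And>i. trace (B i) = 0"
    "\<And>i. mexp (C $ i) = ?G i ** mexp (B i) ** ?G i"
    by metis
  have half: "(1/2) *\<^sub>R A \<in> rdiag0" by (rule subspace_scale[OF subspace_rdiag0 A])
  have G: "texp ((1/2) *\<^sub>R A) $ i = ?G i" for i
    unfolding texp_rdiag0[OF half]
    by (simp add: A\<alpha> scaleR_conv_of_real[where 'a = complex] exp_of_real[symmetric])
  show thesis
  proof (rule that[of "\<chi> i. B i"])
    show "(\<chi> i. B i) \<in> herm0" by (simp add: herm0_def B)
    show "texp C = tmult (texp ((1/2) *\<^sub>R A)) (tmult (texp (\<chi> i. B i)) (texp ((1/2) *\<^sub>R A)))"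
      unfolding vec_eq_iff[of "texp C"] tmult_def vec_lambda_beta G
      by (simp add: texp_def B matrix_mul_assoc)
    have "(norm A)\<^sup>2 + 2 * (A \<bullet> (\<chi> i. B i)) =
       (\<Sum>i\<in>UNIV. (\<Sum>a\<in>UNIV. (\<alpha> i a)\<^sup>2) + 2 * (\<Sum>a\<in>UNIV. \<alpha> i a * Re (B i $ a $ a)))"
      unfolding power2_norm_eq_inner inner_rdiag0[OF A] sum.distrib sum_distrib_left[symmetric]
      by (simp add: \<alpha>_def power2_eq_square)
    also have "\<dots> \<le> (\<Sum>i\<in>UNIV. (norm (C $ i))\<^sup>2)"
      by (intro sum_mono mexp_hermitian_distance_tangent[OF B(1) C'(1) B(2) C'(2) s\<alpha> B(3)])
    finally show "(norm A)\<^sup>2 + 2 * (A \<bullet> (\<chi> i. B i)) \<le> (norm C)\<^sup>2"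
      by (simp add: norm_mtuple_power2)
  qed
qed

text \<open>Directions that stay in the ball for a short time. On the sphere the slope has to be
  strictly inward, since a nonzero tangent direction leaves the ball to second order.\<close>

lemma norm_add_scaleR_le_near_0:
  fixes A D :: "'a::real_inner"
  assumes "norm A \<le> R" "norm A < R \<or> A \<bullet> D < 0"
  shows "\<exists>\<delta>>0. \<forall>h. 0 < h \<and> h < \<delta> \<longrightarrow> norm (A + h *\<^sub>R D) \<le> R"
proof (cases "norm A < R")
  case True
  define \<delta> where "\<delta> = (R - norm A) / (norm D + 1)"
  have "\<delta> > 0" using True by (simp add: \<delta>_def add_nonneg_pos)
  moreover have "norm (A + h *\<^sub>R D) \<le> R" if h: "0 < h" "h < \<delta>" for h
  proof -
    have "norm (A + h *\<^sub>R D) \<le> norm A + h * norm D"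
      using norm_triangle_ineq[of A "h *\<^sub>R D"] h by simp
    also have "h * norm D \<le> \<delta> * (norm D + 1)"
      using h by (intro mult_mono) auto
    also have "\<delta> * (norm D + 1) = R - norm A"
      using norm_ge_zero[of D] by (simp add: \<delta>_def add_nonneg_eq_0_iff)
    finally show ?thesis by simp
  qed
  ultimately show ?thesis by blast
next
  case False
  then have AD: "A \<bullet> D < 0" using assms(2) by simp
  have D2: "D \<bullet> D + 1 > 0" by (simp add: add_nonneg_pos)
  \<comment> \<open>For \<open>h < \<delta>\<close> the quadratic contribution
    \<open>h * (D \<bullet> D)\<close> is at most \<open>- (A \<bullet> D)\<close>, half of what the
    linear term provides.\<close>
  define \<delta> where "\<delta> = - (A \<bullet> D) / (D \<bullet> D + 1)"
  have "\<delta> > 0" using AD D2 by (simp add: \<delta>_def divide_neg_pos)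
  moreover have "norm (A + h *\<^sub>R D) \<le> R" if h: "0 < h" "h < \<delta>" for h
  proof -
    have "h * (D \<bullet> D) \<le> h * (D \<bullet> D + 1)" using h by simp
    also have "\<dots> \<le> \<delta> * (D \<bullet> D + 1)" using h D2 by (intro mult_right_mono) auto
    also have "\<dots> = - (A \<bullet> D)" using D2 by (simp add: \<delta>_def)
    finally have *: "h * (D \<bullet> D) + 2 * (A \<bullet> D) \<le> 0" using AD by linarith
    have "(norm (A + h *\<^sub>R D))\<^sup>2 = (norm A)\<^sup>2 + h * (h * (D \<bullet> D) + 2 * (A \<bullet> D))"
      unfolding power2_norm_eq_inner by (simp add: inner_add_left inner_add_right inner_commute[of D A] algebra_simps)
    also have "\<dots> \<le> (norm A)\<^sup>2" using * h by (simp add: mult_nonneg_nonpos)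
    finally have "norm (A + h *\<^sub>R D) \<le> norm A" by (simp add: norm_le_square power2_norm_eq_inner)
    then show ?thesis using assms(1) by linarith
  qed
  ultimately show ?thesis by blast
qed

context unitary_representation
begin

text \<open>On real diagonal tuples \<open>texp\<close> is an explicit entrywise exponential, so
  continuity follows from that of the polynomial extension of \<open>\<pi>\<close>.\<close>

lemma continuous_on_fv_texp: "continuous_on rdiag0 (\<lambda>X. fv \<pi> H v (texp X))"
proof -
  obtain P where P: "\<And>g. g \<in> SL \<Longrightarrow> \<pi> g = P g" "\<And>x. P differentiable (at x)"
    by (rule extension) blast
  have cP: "continuous_on UNIV P"
    using P(2) by (simp add: continuous_on_eq_continuous_within differentiable_imp_continuous_within)
  have "continuous_on rdiag0 (\<lambda>X :: ('n, 'd) mtuple. if a = b then exp (X $ i $ a $ a) else 0)" for i a b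
    by (cases "a = b") (auto intro!: continuous_intros)
  then have "continuous_on rdiag0 (\<lambda>X :: ('n, 'd) mtuple. (\<chi> i. diag_mat (\<lambda>a. exp (X $ i $ a $ a))))"
    unfolding diag_mat_def by (intro continuous_on_vec_lambda)
  from continuous_on_compose2[OF cP this]
  have c: "continuous_on rdiag0 (\<lambda>X. P (\<chi> i. diag_mat (\<lambda>a. exp (X $ i $ a $ a))))" by simp
  have "continuous_on rdiag0 (\<lambda>X. Re (\<Sum>q\<in>UNIV.
      (\<Sum>j\<in>UNIV. P (\<chi> i. diag_mat (\<lambda>a. exp (X $ i $ a $ a))) $ q $ j * v $ j) * H v (axis q 1)))"
    by (intro continuous_intros c)
  moreover have "fv \<pi> H v (texp X) = Re (\<Sum>q\<in>UNIV.
      (\<Sum>j\<in>UNIV. P (\<chi> i. diag_mat (\<lambda>a. exp (X $ i $ a $ a))) $ q $ j * v $ j) * H v (axis q 1))"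
    if "X \<in> rdiag0" for X
  proof -
    have "\<pi> (texp X) = P (\<chi> i. diag_mat (\<lambda>a. exp (X $ i $ a $ a)))"
      using P(1)[OF texp_in_SL[of X]] that rdiag0_subset_herm0 texp_rdiag0[OF that] by auto
    then show ?thesis
      unfolding fv_def by (subst H_expand_right) (simp add: matrix_vector_mult_def)
  qed
  ultimately show ?thesis by (simp cong: continuous_on_cong)
qed

lemma rep_vector_nonzero:
  assumes "g \<in> SL" "v \<noteq> 0"
  shows "\<pi> g *v v \<noteq> 0"
proof
  assume "\<pi> g *v v = 0"
  moreover obtain M where "M ** \<pi> g = mat 1"
    using rep assms(1) unfolding rational_representation_def invertible_def by blast
  ultimately show False
    using assms(2) by (metis matrix_vector_mul_assoc matrix_vector_mul_lid matrix_vector_mult_0_right)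
qed

lemma torus_minimum_is_minimum:
  assumes v: "v \<noteq> 0" and moment: "\<And>t. t \<in> ST \<Longrightarrow> moment_T \<pi> H (\<pi> t *v v) = moment_G \<pi> H (\<pi> t *v v)"
    and R: "R > 0" and A: "A \<in> rdiag0" "norm A \<le> R"
    and min: "\<And>X. X \<in> rdiag0 \<Longrightarrow> norm X \<le> R \<Longrightarrow> fv \<pi> H v (texp A) \<le> fv \<pi> H v (texp X)"
    and C: "C \<in> herm0" "norm C \<le> R"
  shows "fv \<pi> H v (texp A) \<le> fv \<pi> H v (texp C)"
proof -
  define A2 where "A2 = (1/2) *\<^sub>R A"
  have A2: "A2 \<in> rdiag0" unfolding A2_def by (rule subspace_scale[OF subspace_rdiag0 A(1)])
  have A2': "A2 \<in> herm0" using A2 rdiag0_subset_herm0 by blast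
  define w where "w = \<pi> (texp A2) *v v"
  have w: "w \<noteq> 0" unfolding w_def by (rule rep_vector_nonzero[OF texp_in_SL[OF A2'] v])
  have SLm: "tmult g h \<in> SL" if "g \<in> SL" "h \<in> SL" for g h :: "('n, 'd) mtuple"
    using that by (simp add: SL_def tmult_def det_mul)
  \<comment> \<open>Self-adjointness moves the left factor \<open>\<pi> (texp A2)\<close> into the
    other slot, which turns the value at a conjugated point into an expectation at
    \<open>w\<close>.\<close>
  have conj: "fv \<pi> H v (tmult (texp A2) (tmult g (texp A2))) = Re (H w (\<pi> g *v w))" if "g \<in> SL" for g
    using that texp_in_SL[OF A2'] rep_texp_selfadjoint[OF A2']
    by (simp add: fv_def w_def rep_mult SLm matrix_vector_mul_assoc[symmetric])
  \<comment> \<open>Diagonal tuples commute, so in torus directions the geodesic through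
    \<open>texp A\<close> is the exponential of a straight line.\<close>
  have AD: "fv \<pi> H v (texp (A + D)) = Re (H w (\<pi> (texp D) *v w))" if D: "D \<in> rdiag0" for D
  proof -
    have "tmult (texp A2) (tmult (texp D) (texp A2)) = texp (A2 + (D + A2))"
      using A2 D by (simp add: texp_rdiag0_mult subspace_add[OF subspace_rdiag0])
    also have "A2 + (D + A2) = (A2 + A2) + D"
      by (simp only: add_ac)
    also have "A2 + A2 = A"
      unfolding A2_def scaleR_add_left[symmetric] by simp
    finally show ?thesis
      using conj[OF texp_in_SL[of D]] D rdiag0_subset_herm0 by auto
  qed
  have A0: "fv \<pi> H v (texp A) = Re (H w w)"
  proof -
    have "texp (0 :: ('n, 'd) mtuple) = tone"
      using texp_rdiag0[OF subspace_0[OF subspace_rdiag0]] by (simp add: tone_def diag_mat_1)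
    then show ?thesis using AD[OF subspace_0[OF subspace_rdiag0]] rep_one by simp
  qed
  obtain l where l: "linear l" "\<And>X. X \<in> herm0 \<Longrightarrow> Re (H w (lie_rep \<pi> X *v w)) = l X"
    by (rule lie_rep_expectation_linear) blast
  \<comment> \<open>First-order optimality of \<open>A\<close>, for directions that remain feasible
    for a short time.\<close>
  have nonneg: "0 \<le> l D" if D: "D \<in> rdiag0" and dir: "norm A < R \<or> A \<bullet> D < 0" for D
  proof (rule ccontr)
    assume "\<not> 0 \<le> l D"
    moreover have D': "D \<in> herm0" using D rdiag0_subset_herm0 by blast
    define \<phi> where "\<phi> t = Re (H w (\<pi> (texp (t *\<^sub>R D)) *v w))" for t
    have "(\<phi> has_real_derivative l D) (at 0)"
      unfolding \<phi>_def l(2)[OF D', symmetric] by (rule has_real_derivative_expectation(1)[OF D'])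
    ultimately obtain \<delta> where \<delta>: "\<delta> > 0" "\<And>h. 0 < h \<Longrightarrow> h < \<delta> \<Longrightarrow> \<phi> h < \<phi> 0"
      using DERIV_neg_dec_right[of \<phi> "l D" 0] by auto
    obtain \<delta>' where \<delta>': "\<delta>' > 0" "\<And>h. 0 < h \<Longrightarrow> h < \<delta>' \<Longrightarrow> norm (A + h *\<^sub>R D) \<le> R"
      using norm_add_scaleR_le_near_0[OF A(2) dir] by blast
    define h where "h = min \<delta> \<delta>' / 2"
    have h: "0 < h" "h < \<delta>" "h < \<delta>'" using \<delta>(1) \<delta>'(1) by (auto simp: h_def)
    have hD: "h *\<^sub>R D \<in> rdiag0" by (rule subspace_scale[OF subspace_rdiag0 D])
    have "fv \<pi> H v (texp A) \<le> fv \<pi> H v (texp (A + h *\<^sub>R D))"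
      using h \<delta>' by (intro min subspace_add[OF subspace_rdiag0 A(1) hD]) auto
    then have "fv \<pi> H v (texp A) \<le> \<phi> h" using AD[OF hD] by (simp add: \<phi>_def)
    moreover have "fv \<pi> H v (texp A) = \<phi> 0"
      using AD[OF subspace_0[OF subspace_rdiag0]] by (simp add: \<phi>_def)
    ultimately show False using \<delta>(2)[OF h(1,2)] by simp
  qed
  obtain B where B: "B \<in> herm0" "texp C = tmult (texp A2) (tmult (texp B) (texp A2))"
    "(norm A)\<^sup>2 + 2 * (A \<bullet> B) \<le> (norm C)\<^sup>2"
    unfolding A2_def by (rule herm0_geodesic_exists[OF A(1) C(1)]) blast
  define D where "D = tdiag B"
  have D: "D \<in> rdiag0" unfolding D_def by (rule tdiag_in_rdiag0[OF B(1)])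
  have lD: "0 \<le> l D"
  proof (cases "norm A < R")
    case False
    then have nA: "norm A = R" using A(2) by simp
    have "(norm C)\<^sup>2 \<le> R\<^sup>2" using C(2) by (intro power_mono) auto
    then have AB: "A \<bullet> D \<le> 0"
      using B(3) nA inner_tdiag[OF A(1), of B] by (simp add: D_def)
    \<comment> \<open>At a boundary minimiser \<open>D\<close> may be tangent to the sphere. Tilting
      it by \<open>- \<epsilon> *\<^sub>R A\<close> makes it strictly inward because
      \<open>R > 0\<close>; \<epsilon> then tends to 0.\<close>
    have *: "\<epsilon> * l A \<le> l D" if "\<epsilon> > 0" for \<epsilon>
    proof -
      have "A \<bullet> (D - \<epsilon> *\<^sub>R A) = A \<bullet> D - \<epsilon> * R\<^sup>2"
        by (simp add: inner_diff_right power2_norm_eq_inner[symmetric] nA)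
      moreover have "\<epsilon> * R\<^sup>2 > 0" using R that by simp
      ultimately have "A \<bullet> (D - \<epsilon> *\<^sub>R A) < 0" using AB by linarith
      moreover have "D - \<epsilon> *\<^sub>R A \<in> rdiag0"
        by (intro subspace_diff[OF subspace_rdiag0 D] subspace_scale[OF subspace_rdiag0 A(1)])
      ultimately have "0 \<le> l (D - \<epsilon> *\<^sub>R A)" by (intro nonneg) auto
      then show ?thesis using l(1) by (simp add: linear_diff linear_scale)
    qed
    have "((\<lambda>\<epsilon>. \<epsilon> * l A) \<longlongrightarrow> 0 * l A) (at_right 0)" by (intro tendsto_intros)
    then have "0 * l A \<le> l D"
      by (rule tendsto_upperbound) (auto intro!: * eventually_at_right_less[THEN eventually_mono])
    then show ?thesis by simp
  qed (use nonneg[OF D] in simp)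
  \<comment> \<open>The hypothesis on the moment maps enters at the torus point
    \<open>texp A2\<close>, half way along the geodesic from the identity to
    \<open>texp A\<close>.\<close>
  have "moment_T \<pi> H w = moment_G \<pi> H w"
    unfolding w_def by (rule moment[OF texp_rdiag0_in_ST[OF A2]])
  then have "Re (H w (lie_rep \<pi> B *v w)) = l D"
    using lie_rep_expectation_tdiag[OF w _ B(1)] l(2)[of D] D rdiag0_subset_herm0 by (auto simp: D_def)
  then have "Re (H w w) \<le> Re (H w (\<pi> (texp B) *v w))"
    using expectation_tangent[OF B(1), of w] lD by simp
  then show ?thesis
    unfolding A0 B(2) conj[OF texp_in_SL[OF B(1)]] .
qed

end

theorem theorem4p20:
  fixes \<pi> :: "('n::finite, 'd::finite) mtuple \<Rightarrow> complex^'m^'m"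
    and H :: "complex^'m \<Rightarrow> complex^'m \<Rightarrow> complex"
    and v :: "complex^'m"
    and R :: real
  assumes "rational_representation \<pi>"
    and "hermitian_inner_product H"
    and "SU_invariant \<pi> H"
    and "v \<noteq> 0"
    and "\<forall>t\<in>ST. moment_T \<pi> H (\<pi> t *v v) = moment_G \<pi> H (\<pi> t *v v)"
    and "R > 0"
  shows "(INF g\<in>geodesic_ball R. fv \<pi> H v g) = (INF g\<in>ST \<inter> geodesic_ball R. fv \<pi> H v g)"
proof -
  interpret unitary_representation \<pi> H
    using assms(1-3) by unfold_locales
  let ?S = "{X :: ('n, 'd) mtuple. X \<in> rdiag0 \<and> norm X \<le> R}"
  have S: "?S = rdiag0 \<inter> cball 0 R" by auto
  have "compact ?S"
    unfolding S by (intro closed_Int_compact closed_subspace subspace_rdiag0 compact_cball)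
  moreover have "0 \<in> ?S" using assms(6) subspace_0[OF subspace_rdiag0] by simp
  moreover have "continuous_on ?S (\<lambda>X. fv \<pi> H v (texp X))"
    by (rule continuous_on_subset[OF continuous_on_fv_texp]) auto
  ultimately obtain A where A: "A \<in> rdiag0" "norm A \<le> R"
    and min: "\<And>X. X \<in> rdiag0 \<Longrightarrow> norm X \<le> R \<Longrightarrow> fv \<pi> H v (texp A) \<le> fv \<pi> H v (texp X)"
    using continuous_attains_inf[of ?S] by blast
  have le: "fv \<pi> H v (texp A) \<le> fv \<pi> H v g" if "g \<in> geodesic_ball R" for g
    using that torus_minimum_is_minimum[OF assms(4) _ assms(6) A min] assms(5)
    unfolding geodesic_ball_def by blast
  \<comment> \<open>The lower bound \<open>le\<close> holds on the whole ball, so both infima of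
    reals are well defined, and it is attained at a point of both sets.\<close>
  have T: "texp A \<in> ST \<inter> geodesic_ball R"
    using A texp_rdiag0_in_ST rdiag0_subset_herm0 by (auto simp: geodesic_ball_def)
  show ?thesis
  proof (rule antisym)
    show "(INF g\<in>geodesic_ball R. fv \<pi> H v g) \<le> (INF g\<in>ST \<inter> geodesic_ball R. fv \<pi> H v g)"
      using T le by (intro cINF_superset_mono) (auto intro!: bdd_belowI2)
    have "(INF g\<in>ST \<inter> geodesic_ball R. fv \<pi> H v g) \<le> fv \<pi> H v (texp A)"
      using le by (intro cINF_lower[OF _ T] bdd_belowI2[of _ "fv \<pi> H v (texp A)"]) auto
    also have "\<dots> \<le> (INF g\<in>geodesic_ball R. fv \<pi> H v g)"
      using T by (intro cINF_greatest le) auto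
    finally show "(INF g\<in>ST \<inter> geodesic_ball R. fv \<pi> H v g) \<le> (INF g\<in>geodesic_ball R. fv \<pi> H v g)" .
  qed
qed

end
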